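(* Let $\Psi:[1,\infty)\to\mathbb{R}_+$ be a non-decreasing function and let $C>0$. Then \[ \dim_{\mathrm{H}}\Big(G(\Psi)\setminus \mathcal{K}(C\Psi)\Big)=\frac{2}{\tau+2},\qquad\text{where }\ \tau=\liminf_{q\to\infty}\frac{\log\Psi(q)}{\log q}. \]
   Context: Every $x\in[0,1)$ has a simple continued fraction expansion $x=[a_1(x),a_2(x),\dots]$ with positive integer partial quotients $a_n(x)$; $p_n(x)/q_n(x)=[a_1(x),\dots,a_n(x)]$ (in lowest terms) is the $n$-th convergent, with $q_n$ given by $q_{-1}=0$, $q_0=1$, $q_{n+1}=a_{n+1}(x)q_n+q_{n-1}$. For a function $\Phi:[1,\infty)\to\mathbb{R}_+$ define \[ G(\Phi):=\big\{x\in[0,1): a_n(x)a_{n+1}(x)>\Phi(q_n(x)) \text{ for infinitely many } n\in\mathbb{N}\big\}, \] \[ \mathcal{K}(\Phi):=\Big\{x\in[0,1): \Big|x-\frac{p}{q}\Big|<\frac{1}{q^2\Phi(q)} \text{ for infinitely many } (p,q)\in\mathbb{Z}\times\mathbb{N}\Big\}, \] and $C\Psi$ denotes the function $q\mapsto C\Psi(q)$. $\dim_{\mathrm{H}}$ denotes Hausdorff dimension.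
   Formalization: The formal statement additionally assumes that Ψ(q) tends to infinity; for bounded Ψ the printed formula always fails (e.g. Ψ = 1, C = 1/2 gives the empty set, of dimension 0, while the formula gives 1). *)

theory Defs
  imports "HOL-Analysis.Analysis"
begin

(* The convention is diam(U)^0 = 1 for every nonempty U, whereas 0 powr 0 = 0. *)
definition diam_pow :: "real \<Rightarrow> 'a::metric_space set \<Rightarrow> ennreal" where
  "diam_pow s U = (if U = {} then 0 else if s = 0 then 1 else ennreal (diameter U powr s))"

(* Boundedness is required because diameter takes an unspecified value on unbounded sets.
   Finite covers are included: pad them with empty sets. *)
definition hausdorff_premeasure :: "real \<Rightarrow> real \<Rightarrow> 'a::metric_space set \<Rightarrow> ennreal" where
  "hausdorff_premeasure s \<delta> A =
     (INF U\<in>{U :: nat \<Rightarrow> 'a set. A \<subseteq> (\<Union>i. U i) \<and> (\<forall>i. bounded (U i) \<and> diameter (U i) \<le> \<delta>)}.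
        \<Sum>i. diam_pow s (U i))"

definition hausdorff_measure :: "real \<Rightarrow> 'a::metric_space set \<Rightarrow> ennreal" where
  "hausdorff_measure s A = (SUP \<delta>\<in>{0<..}. hausdorff_premeasure s \<delta> A)"

definition hausdorff_dim :: "'a::metric_space set \<Rightarrow> ereal" where
  "hausdorff_dim A = Inf {ereal s | s. 0 \<le> s \<and> hausdorff_measure s A = 0}"

definition gauss_map :: "real \<Rightarrow> real" where
  "gauss_map x = (if x = 0 then 0 else frac (1 / x))"

(* Partial quotients are numbered from 1 (the value at index 0 is not used).  The expansion
   of a rational number is finite: a_n(x) exists iff the (n - 1)-st iterate of the Gauss map
   at x is nonzero, and cf_quot x n = 0 otherwise. *)
definition cf_quot :: "real \<Rightarrow> nat \<Rightarrow> nat" where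
  "cf_quot x n = nat \<lfloor>1 / (gauss_map ^^ (n - 1)) x\<rfloor>"

(* The second equation is the recurrence with q_{-1} = 0 and q_0 = 1. *)
fun cf_denom :: "real \<Rightarrow> nat \<Rightarrow> nat" where
  "cf_denom x 0 = 1"
| "cf_denom x (Suc 0) = cf_quot x 1"
| "cf_denom x (Suc (Suc n)) = cf_quot x (Suc (Suc n)) * cf_denom x (Suc n) + cf_denom x n"

(* The conjunct on the n-th iterate says that a_{n+1}(x), hence also a_n(x), exists. *)
definition G_set :: "(real \<Rightarrow> real) \<Rightarrow> real set" where
  "G_set \<Phi> = {x \<in> {0..<1}. infinite {n :: nat. n \<ge> 1 \<and> (gauss_map ^^ n) x \<noteq> 0 \<and>
      real (cf_quot x n) * real (cf_quot x (n + 1)) > \<Phi> (real (cf_denom x n))}}"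

definition K_set :: "(real \<Rightarrow> real) \<Rightarrow> real set" where
  "K_set \<Phi> = {x \<in> {0..<1}. infinite {(p :: int, q :: nat). q \<ge> 1 \<and>
      \<bar>x - real_of_int p / real q\<bar> < 1 / ((real q)\<^sup>2 * \<Phi> (real q))}}"

end

theory Submission
  imports Defs
begin

text \<open>
  Upper bound: if \<open>a\<^sub>n a\<^sub>n\<^sub>+\<^sub>1 > q\<^sup>\<tau>\<close> with \<open>q = q\<^sub>n\<close> and \<open>r = q\<^sub>n\<^sub>-\<^sub>1\<close>, then \<open>a\<^sub>n r \<le> q\<close> gives
  \<open>\<bar>x - p\<^sub>n / q\<bar> \<le> 1 / (r q\<^sup>1\<^sup>+\<^sup>\<tau>)\<close>, and \<open>p\<^sub>n\<close> is determined by \<open>q\<close>, \<open>r\<close> and the parity of \<open>n\<close> because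
  \<open>p\<^sub>n r \<equiv> \<plusminus>1\<close> modulo \<open>q\<close>. So \<open>G\<close> is covered infinitely often by balls indexed by \<open>(q, r)\<close>, and
  \<open>\<Sum> (r q\<^sup>1\<^sup>+\<^sup>\<tau>)\<^sup>-\<^sup>s\<close> over \<open>r \<le> q\<close> converges as soon as \<open>s (2 + \<tau>) > 2\<close>.

  Lower bound: a tree of continued fractions carries a probability. Usually the digits range over
  \<open>1, \<dots>, N\<close> with mass proportional to Lebesgue measure, which for large \<open>N\<close> has dimension close to 1.
  At very sparse scales where \<open>\<Psi>(q) \<le> q\<^sup>\<beta>\<close> with \<open>\<beta>\<close> close to \<open>\<tau>\<close>, a fixed digit \<open>M\<close> is inserted, followed
  by a digit uniformly chosen among about \<open>\<Psi>(q) / M\<close> values just above \<open>\<Psi>(q) / M\<close>. Such points lie in \<open>G(\<Psi>)\<close>;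
  as \<open>M\<close> is large compared with \<open>1 / C\<close>, all their digits satisfy \<open>a\<^sub>n\<^sub>+\<^sub>1 + 2 \<le> C \<Psi>(q\<^sub>n)\<close> for large \<open>n\<close>,
  which by the best approximation property keeps them out of \<open>K(C\<Psi>)\<close>. Splitting \<open>[0, 1)\<close> along the
  masses sends \<open>y \<in> [0, 1)\<close> to a point \<open>g y\<close> with \<open>\<bar>y - z\<bar> \<le> c \<bar>g y - g z\<bar>\<^sup>s\<close>, and Lebesgue measure then
  bounds the \<open>s\<close>-dimensional Hausdorff measure from below.
\<close>

section \<open>Hausdorff measure\<close>

text \<open>A mass distribution principle: pulled back along \<open>g\<close>, each set
  \<open>U\<close> of a cover of \<open>A\<close> lies in an interval of length
  \<open>2 * c * diameter U powr s\<close>, and these intervals must have total length at least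
  1.\<close>

lemma hausdorff_measure_nonzero:
  fixes g :: "real \<Rightarrow> 'a::metric_space"
  assumes s: "s > 0" and c: "c > 0"
    and g: "\<And>y. y \<in> {0..<1} \<Longrightarrow> g y \<in> A"
    and expand: "\<And>y z. y \<in> {0..<1} \<Longrightarrow> z \<in> {0..<1} \<Longrightarrow> \<bar>y - z\<bar> \<le> c * dist (g y) (g z) powr s"
  shows "hausdorff_measure s A \<noteq> 0"
proof
  assume "hausdorff_measure s A = 0"
  moreover have "hausdorff_premeasure s 1 A \<le> hausdorff_measure s A"
    unfolding hausdorff_measure_def by (rule SUP_upper) simp
  ultimately have "hausdorff_premeasure s 1 A < ennreal (1 / (2 * c))"
    using c by simp
  then obtain U :: "nat \<Rightarrow> 'a set" where cover: "A \<subseteq> (\<Union>i. U i)" and bd: "\<And>i. bounded (U i)"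
    and small: "(\<Sum>i. diam_pow s (U i)) < ennreal (1 / (2 * c))"
    unfolding hausdorff_premeasure_def INF_less_iff by auto
  define V where "V i = {y \<in> {0..<1}. g y \<in> U i}" for i
  define y0 where "y0 i = (SOME y. y \<in> V i)" for i
  define D where "D i = c * diameter (U i) powr s" for i
  \<comment> \<open>The preimage \<open>V i\<close> may fail to be measurable; a closed interval
    around one of its points replaces it.\<close>
  define W where "W i = (if V i = {} then {} else {y0 i - D i..y0 i + D i})" for i
  have VW: "V i \<subseteq> W i" for i
  proof
    fix y assume y: "y \<in> V i"
    then have y0: "y0 i \<in> V i"
      unfolding y0_def by (metis someI)
    have "\<bar>y - y0 i\<bar> \<le> c * dist (g y) (g (y0 i)) powr s"
      using y y0 expand by (simp add: V_def)
    also have "\<dots> \<le> D i"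
      using y y0 c s bd unfolding D_def
      by (intro mult_left_mono powr_mono2) (auto simp: V_def diameter_bounded_bound)
    finally show "y \<in> W i"
      using y by (auto simp: W_def)
  qed
  have emW: "emeasure lborel (W i) \<le> ennreal (2 * c) * diam_pow s (U i)" for i
  proof (cases "V i = {}")
    case False
    then have "U i \<noteq> {}"
      by (auto simp: V_def)
    moreover have "D i \<ge> 0"
      using c by (simp add: D_def)
    ultimately show ?thesis
      using False s c by (simp add: W_def D_def diam_pow_def flip: ennreal_mult)
  qed (simp add: W_def)
  have "{0..<1} \<subseteq> (\<Union>i. W i)"
  proof
    fix y :: real assume y: "y \<in> {0..<1}"
    then obtain i where "g y \<in> U i"
      using g cover by blast
    then show "y \<in> (\<Union>i. W i)"
      using VW[of i] y by (auto simp: V_def)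
  qed
  have W: "range W \<subseteq> sets lborel"
    by (auto simp: W_def)
  have "1 = emeasure lborel {0..<1::real}"
    by simp
  also have "\<dots> \<le> emeasure lborel (\<Union>i. W i)"
    using W \<open>{0..<1} \<subseteq> (\<Union>i. W i)\<close> by (intro emeasure_mono) auto
  also have "\<dots> \<le> (\<Sum>i. emeasure lborel (W i))"
    by (rule emeasure_subadditive_countably[OF W])
  also have "\<dots> \<le> (\<Sum>i. ennreal (2 * c) * diam_pow s (U i))"
    using emW by (intro suminf_le) auto
  also have "\<dots> = ennreal (2 * c) * (\<Sum>i. diam_pow s (U i))"
    by (rule ennreal_suminf_cmult)
  also have "\<dots> < ennreal (2 * c) * ennreal (1 / (2 * c))"
    using small c by (intro ennreal_mult_strict_left_mono) auto
  also have "\<dots> = 1"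
    using c by (simp flip: ennreal_mult)
  finally show False
    by simp
qed

section \<open>Monotonicity in the set, the scale and the exponent\<close>

lemma hausdorff_premeasure_mono:
  assumes "A \<subseteq> B"
  shows "hausdorff_premeasure s \<delta> A \<le> hausdorff_premeasure s \<delta> B"
  unfolding hausdorff_premeasure_def using assms by (intro INF_superset_mono) auto

lemma hausdorff_measure_mono: "A \<subseteq> B \<Longrightarrow> hausdorff_measure s A \<le> hausdorff_measure s B"
  unfolding hausdorff_measure_def by (intro SUP_mono) (blast intro: hausdorff_premeasure_mono)

lemma hausdorff_premeasure_antimono_delta:
  assumes "\<delta> \<le> \<epsilon>"
  shows "hausdorff_premeasure s \<epsilon> A \<le> hausdorff_premeasure s \<delta> A"
  unfolding hausdorff_premeasure_def using assms by (intro INF_superset_mono) (use order_trans in blast)+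

text \<open>On sets of diameter at most 1 the larger exponent gives the smaller power, and
  restricting to such covers only raises the premeasure.\<close>

lemma hausdorff_measure_eq_0_mono:
  fixes A :: "'a::metric_space set"
  assumes "hausdorff_measure s A = 0" "0 \<le> s" "s < t"
  shows "hausdorff_measure t A = 0"
proof -
  have le: "diam_pow t U \<le> diam_pow s U" if "bounded U" "diameter U \<le> 1" for U :: "'a set"
  proof -
    have "diameter U \<ge> 0"
      using that diameter_ge_0 by blast
    moreover have "diameter U powr t \<le> diameter U powr s" if "s > 0"
      using powr_mono'[of s t "diameter U"] assms that \<open>diameter U \<le> 1\<close> \<open>diameter U \<ge> 0\<close> by simp
    \<comment> \<open>This serves the exponent \<open>s = 0\<close>, where \<open>diam_pow\<close>
      is 1 on every nonempty set.\<close>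
    moreover have "diameter U powr t \<le> 1"
      using powr_mono2[of t "diameter U" 1] assms that \<open>diameter U \<ge> 0\<close> by simp
    ultimately show ?thesis
      using assms by (auto simp: diam_pow_def intro!: ennreal_leI)
  qed
  have "hausdorff_premeasure t \<delta> A \<le> 0" if "\<delta> > 0" for \<delta>
  proof -
    have "hausdorff_premeasure t \<delta> A \<le> hausdorff_premeasure t (min \<delta> 1) A"
      by (rule hausdorff_premeasure_antimono_delta) simp
    also have "\<dots> \<le> hausdorff_premeasure s (min \<delta> 1) A"
      unfolding hausdorff_premeasure_def
      by (intro INF_superset_mono suminf_le le) auto
    also have "\<dots> \<le> hausdorff_measure s A"
      unfolding hausdorff_measure_def using that by (intro SUP_upper) simp
    finally show ?thesis
      using assms by simp
  qed
  then show ?thesis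
    unfolding hausdorff_measure_def by (simp add: SUP_eq_iff bot_ennreal)
qed

section \<open>Borel-Cantelli argument for limsup sets of balls\<close>

text \<open>The balls of index at least \<open>n\<close> still cover \<open>A\<close>, since each
  point lies in infinitely many; their radii and the sum of the powers tend to 0 as \<open>n\<close>
  grows.\<close>

lemma hausdorff_cantelli_nat:
  fixes c :: "nat \<Rightarrow> 'a::real_normed_vector"
  assumes s: "s > 0" and \<rho>: "\<And>i. \<rho> i \<ge> 0" and sum: "summable (\<lambda>i. \<rho> i powr s)"
    and inf: "\<And>x. x \<in> A \<Longrightarrow> infinite {i. dist x (c i) \<le> \<rho> i}"
  shows "hausdorff_measure s A = 0"
proof -
  have "hausdorff_premeasure s \<delta> A \<le> 0" if "\<delta> > 0" for \<delta>
  proof (rule ennreal_le_epsilon)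
    fix e :: real assume "e > 0"
    have "(\<lambda>i. \<rho> i powr s) \<longlonglongrightarrow> 0"
      using sum by (rule summable_LIMSEQ_zero)
    then have "\<forall>\<^sub>F i in sequentially. \<rho> i powr s < (\<delta> / 2) powr s"
      using \<open>\<delta> > 0\<close> by (intro order_tendstoD) auto
    then obtain N1 where N1: "\<And>i. i \<ge> N1 \<Longrightarrow> \<rho> i powr s < (\<delta> / 2) powr s"
      unfolding eventually_sequentially by blast
    have small: "\<rho> i \<le> \<delta> / 2" if "i \<ge> N1" for i
      using N1[OF that] powr_mono2[of s "\<delta> / 2" "\<rho> i"] s \<open>\<delta> > 0\<close> by linarith
    have sum_n: "summable (\<lambda>i. \<rho> (i + n) powr s)" for n
      using sum by (rule summable_ignore_initial_segment)
    have "(\<lambda>n. \<Sum>i. \<rho> (i + n) powr s) \<longlonglongrightarrow> 0"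
      by (rule suminf_exist_split2[OF sum])
    then have "\<forall>\<^sub>F n in sequentially. (\<Sum>i. \<rho> (i + n) powr s) < e / 2 powr s"
      using \<open>e > 0\<close> by (intro order_tendstoD) auto
    then obtain N2 where N2: "\<And>n. n \<ge> N2 \<Longrightarrow> (\<Sum>i. \<rho> (i + n) powr s) < e / 2 powr s"
      unfolding eventually_sequentially by blast
    define n where "n = max N1 N2"
    define U where "U i = cball (c (i + n)) (\<rho> (i + n))" for i
    have diam: "diameter (U i) \<le> 2 * \<rho> (i + n)" for i
    proof (unfold U_def, rule diameter_le)
      show "norm (x - y) \<le> 2 * \<rho> (i + n)" if "x \<in> cball (c (i + n)) (\<rho> (i + n))" "y \<in> cball (c (i + n)) (\<rho> (i + n))" for x y
        using that dist_triangle3[of x y "c (i + n)"] by (simp add: dist_norm)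
    qed (use \<rho> in auto)
    have "A \<subseteq> (\<Union>i. U i)"
    proof
      fix x assume "x \<in> A"
      then obtain i where "i \<ge> n" "dist x (c i) \<le> \<rho> i"
        using inf[OF \<open>x \<in> A\<close>] by (auto simp: infinite_nat_iff_unbounded_le)
      then show "x \<in> (\<Union>i. U i)"
        by (intro UN_I[of "i - n"]) (auto simp: U_def dist_commute)
    qed
    moreover have "bounded (U i)" "diameter (U i) \<le> \<delta>" for i
      using diam[of i] small[of "i + n"] unfolding n_def U_def by fastforce+
    ultimately have "hausdorff_premeasure s \<delta> A \<le> (\<Sum>i. diam_pow s (U i))"
      unfolding hausdorff_premeasure_def by (intro INF_lower) auto
    also have "\<dots> \<le> (\<Sum>i. ennreal (2 powr s * \<rho> (i + n) powr s))"
    proof (intro suminf_le)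
      fix i
      have "diameter (U i) powr s \<le> (2 * \<rho> (i + n)) powr s"
        using diam[of i] s by (intro powr_mono2) (auto simp: U_def intro: diameter_ge_0)
      then show "diam_pow s (U i) \<le> ennreal (2 powr s * \<rho> (i + n) powr s)"
        using s \<rho> by (auto simp: diam_pow_def powr_mult intro!: ennreal_leI)
    qed auto
    also have "\<dots> = ennreal (2 powr s * (\<Sum>i. \<rho> (i + n) powr s))"
      using sum_n[of n] by (subst suminf_ennreal2) (simp_all add: suminf_mult summable_mult)
    also have "\<dots> \<le> ennreal e"
      using N2[of n] by (intro ennreal_leI) (auto simp: n_def field_simps)
    finally show "hausdorff_premeasure s \<delta> A \<le> 0 + ennreal e"
      by simp
  qed
  then show ?thesis
    unfolding hausdorff_measure_def by (simp add: SUP_eq_iff bot_ennreal)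
qed

text \<open>Enumerating the index type reduces this to sequences; it will be applied to balls
  indexed by two consecutive denominators and a parity.\<close>

lemma hausdorff_cantelli:
  fixes c :: "'i::countable \<Rightarrow> 'a::real_normed_vector"
  assumes "infinite (UNIV :: 'i set)" and s: "s > 0" and \<rho>: "\<And>i. \<rho> i \<ge> 0"
    and sum: "(\<lambda>i. \<rho> i powr s) summable_on UNIV"
    and inf: "\<And>x. x \<in> A \<Longrightarrow> infinite {i. dist x (c i) \<le> \<rho> i}"
  shows "hausdorff_measure s A = 0"
proof -
  define f :: "nat \<Rightarrow> 'i" where "f = from_nat_into UNIV"
  have f: "bij f"
    unfolding f_def using assms(1) by (intro bij_betw_from_nat_into) auto
  have "(\<lambda>k. \<rho> (f k) powr s) summable_on UNIV"
    using summable_on_reindex_bij_betw[OF f, of "\<lambda>i. \<rho> i powr s"] sum by simp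
  then have "summable (\<lambda>k. \<rho> (f k) powr s)"
    by (rule summable_on_imp_summable)
  moreover have "infinite {k. dist x (c (f k)) \<le> \<rho> (f k)}" if "x \<in> A" for x
  proof
    assume "finite {k. dist x (c (f k)) \<le> \<rho> (f k)}"
    then have "finite (f ` {k. dist x (c (f k)) \<le> \<rho> (f k)})"
      by simp
    also have "f ` {k. dist x (c (f k)) \<le> \<rho> (f k)} = {i. dist x (c i) \<le> \<rho> i}"
      using f by (auto simp: bij_def surj_def image_iff)
    finally show False
      using inf[OF that] by simp
  qed
  ultimately show ?thesis
    using hausdorff_cantelli_nat[of s "\<lambda>k. \<rho> (f k)" A "\<lambda>k. c (f k)"] s \<rho> by simp
qed

section \<open>Continued fractions\<close>

definition cf_tail :: "real \<Rightarrow> nat \<Rightarrow> real" where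
  "cf_tail x n = (gauss_map ^^ n) x"

text \<open>Exactly the irrational numbers in [0, 1).\<close>

definition cf_infinite :: "real \<Rightarrow> bool" where
  "cf_infinite x \<longleftrightarrow> x \<in> {0..<1} \<and> (\<forall>n. cf_tail x n \<noteq> 0)"

text \<open>With p_{-1} = 1 and p_0 = 0 the recurrence gives 1 at index 1 whatever the first digit
  is.\<close>

fun cf_numer :: "real \<Rightarrow> nat \<Rightarrow> nat" where
  "cf_numer x 0 = 0"
| "cf_numer x (Suc 0) = 1"
| "cf_numer x (Suc (Suc n)) = cf_quot x (Suc (Suc n)) * cf_numer x (Suc n) + cf_numer x n"

lemma cf_tail_0 [simp]: "cf_tail x 0 = x"
  by (simp add: cf_tail_def)

lemma cf_tail_Suc: "cf_tail x (Suc n) = gauss_map (cf_tail x n)"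
  by (simp add: cf_tail_def)

lemma cf_quot_Suc: "cf_quot x (Suc n) = nat \<lfloor>1 / cf_tail x n\<rfloor>"
  by (simp add: cf_quot_def cf_tail_def)

lemma gauss_map_bounds: "gauss_map x \<in> {0..<1}"
  by (simp add: gauss_map_def frac_lt_1)

lemma cf_tail_bounds:
  assumes "cf_infinite x"
  shows "0 < cf_tail x n" "cf_tail x n < 1"
proof -
  have "cf_tail x n \<in> {0..<1}"
    using assms gauss_map_bounds by (cases n) (auto simp: cf_infinite_def cf_tail_Suc simp del: atLeastLessThan_iff)
  moreover have "cf_tail x n \<noteq> 0"
    using assms by (simp add: cf_infinite_def)
  ultimately show "0 < cf_tail x n" "cf_tail x n < 1"
    by auto
qed

lemma inverse_cf_tail:
  assumes "cf_infinite x"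
  shows "1 / cf_tail x n = cf_quot x (Suc n) + cf_tail x (Suc n)"
proof -
  have "1 / cf_tail x n > 1"
    using cf_tail_bounds[OF assms, of n] by simp
  then show ?thesis
    using cf_tail_bounds[OF assms, of n] by (simp add: cf_quot_Suc cf_tail_Suc gauss_map_def frac_def)
qed

lemma cf_quot_pos:
  assumes "cf_infinite x"
  shows "cf_quot x (Suc n) \<ge> 1"
proof -
  have "1 / cf_tail x n > 1"
    using cf_tail_bounds[OF assms, of n] by simp
  then show ?thesis
    unfolding cf_quot_Suc by linarith
qed

lemma cf_tail_step:
  assumes "cf_infinite x"
  shows "cf_tail x n * (cf_quot x (Suc n) + cf_tail x (Suc n)) = 1"
  using inverse_cf_tail[OF assms, of n] cf_tail_bounds[OF assms, of n] by (simp add: field_simps)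

text \<open>By \<open>cf_tail_step\<close> the last tail times the last bracket is the previous
  bracket, so the product telescopes. Since \<open>cf_error\<close> identifies the product with the
  size of q_n x - p_n, this gives the exact approximation error.\<close>

lemma cf_prod_denom:
  assumes "cf_infinite x"
  shows "(\<Prod>k\<le>n. cf_tail x k) * (cf_denom x (Suc n) + cf_tail x (Suc n) * cf_denom x n) = 1"
proof (induction n)
  case 0
  then show ?case
    using cf_tail_step[OF assms, of 0] by simp
next
  case (Suc n)
  let ?t = "cf_tail x (Suc n)" and ?u = "cf_tail x (Suc (Suc n))"
  have "?t * (cf_denom x (Suc (Suc n)) + ?u * cf_denom x (Suc n))
      = ?t * (cf_quot x (Suc (Suc n)) + ?u) * cf_denom x (Suc n) + ?t * cf_denom x n"
    by (simp add: algebra_simps)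
  then have "?t * (cf_denom x (Suc (Suc n)) + ?u * cf_denom x (Suc n))
      = cf_denom x (Suc n) + ?t * cf_denom x n"
    by (simp only: cf_tail_step[OF assms] mult_1)
  then show ?case
    using Suc by (simp only: prod.atMost_Suc mult.assoc)
qed

text \<open>The errors obey the recurrence of numerators and denominators, and
  \<open>cf_tail_step\<close> turns it into multiplication by minus the next tail.\<close>

lemma cf_error:
  fixes x :: real
  assumes "cf_infinite x"
  shows "cf_denom x n * x - cf_numer x n = (-1) ^ n * (\<Prod>k\<le>n. cf_tail x k)"
proof (induction n rule: induct_nat_012)
  case 1
  have "x * cf_quot x (Suc 0) = 1 - x * cf_tail x (Suc 0)"
    using cf_tail_step[OF assms, of 0] by (simp add: algebra_simps)
  then show ?case
    by (simp add: mult.commute)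
next
  case (ge2 n)
  let ?P = "(-1) ^ n * (\<Prod>k\<le>n. cf_tail x k)" and ?t = "cf_tail x (Suc n)" and ?u = "cf_tail x (Suc (Suc n))"
  let ?a = "cf_quot x (Suc (Suc n))"
  have "cf_denom x (Suc (Suc n)) * x - cf_numer x (Suc (Suc n))
      = ?a * (cf_denom x (Suc n) * x - cf_numer x (Suc n)) + (cf_denom x n * x - cf_numer x n)"
    by (simp add: algebra_simps)
  also have "\<dots> = ?P * (1 - ?t * ?a)"
    unfolding ge2 by (simp add: algebra_simps)
  also have "1 - ?t * ?a = ?t * ?u"
    using cf_tail_step[OF assms, of "Suc n"] by (simp add: algebra_simps)
  finally show ?case
    by (simp add: algebra_simps)
qed simp

lemma cf_det: "int (cf_numer x n) * int (cf_denom x (Suc n)) - int (cf_numer x (Suc n)) * int (cf_denom x n) = (-1) ^ Suc n"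
proof (induction n)
  case (Suc n)
  have "int (cf_numer x (Suc n)) * int (cf_denom x (Suc (Suc n))) - int (cf_numer x (Suc (Suc n))) * int (cf_denom x (Suc n))
     = - (int (cf_numer x n) * int (cf_denom x (Suc n)) - int (cf_numer x (Suc n)) * int (cf_denom x n))"
    by (simp add: algebra_simps)
  then show ?case
    using Suc by simp
qed simp

lemma cf_denom_pos:
  assumes "cf_infinite x"
  shows "cf_denom x n \<ge> 1"
proof (induction n rule: induct_nat_012)
  case 1
  then show ?case using cf_quot_pos[OF assms, of 0] by simp
qed (auto simp: Suc_le_eq)

lemma cf_denom_Suc: "cf_quot x (Suc n) * cf_denom x n \<le> cf_denom x (Suc n)"
  by (cases n) auto

lemma cf_denom_mono:
  assumes "cf_infinite x"
  shows "cf_denom x n \<le> cf_denom x (Suc n)"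
  using cf_denom_Suc[of x n] cf_quot_pos[OF assms, of n]
  by (metis mult_le_mono1 nat_mult_1 order_trans)

lemma cf_denom_Suc_le:
  assumes "cf_infinite x"
  shows "cf_denom x (Suc n) \<le> cf_quot x (Suc n) * cf_denom x n + cf_denom x n"
proof (cases n)
  case (Suc m)
  then show ?thesis
    using cf_denom_mono[OF assms, of m] by simp
qed simp

lemma cf_denom_ge:
  assumes "cf_infinite x"
  shows "n \<le> cf_denom x n"
proof (induction n rule: induct_nat_012)
  case 1
  then show ?case using cf_quot_pos[OF assms, of 0] by simp
next
  case (ge2 n)
  have "cf_denom x (Suc n) + cf_denom x n \<le> cf_denom x (Suc (Suc n))"
    using cf_quot_pos[OF assms, of "Suc n"] by (simp add: Suc_le_eq)
  then show ?case
    using ge2 cf_denom_pos[OF assms, of n] by linarith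
qed simp

lemma cf_numer_le_denom:
  assumes "cf_infinite x"
  shows "cf_numer x n \<le> cf_denom x n"
proof (induction n rule: induct_nat_012)
  case 1
  then show ?case using cf_quot_pos[OF assms, of 0] by simp
next
  case (ge2 n)
  then show ?case by (simp add: add_mono)
qed simp

lemma cf_prod_bounds:
  assumes "cf_infinite x"
  shows "(\<Prod>k\<le>n. cf_tail x k) \<le> 1 / cf_denom x (Suc n)"
    and "1 / (cf_denom x (Suc n) + cf_denom x n) \<le> (\<Prod>k\<le>n. cf_tail x k)"
    and "(\<Prod>k\<le>n. cf_tail x k) > 0"
proof -
  let ?P = "\<Prod>k\<le>n. cf_tail x k" and ?t = "cf_tail x (Suc n)"
  have t: "0 < ?t" "?t < 1"
    using cf_tail_bounds[OF assms] by blast+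
  have q: "real (cf_denom x (Suc n)) \<ge> 1" "real (cf_denom x n) \<ge> 1"
    using cf_denom_pos[OF assms] by simp_all
  have "0 < cf_denom x (Suc n) + ?t * cf_denom x n"
    using t q by (simp add: add_pos_pos)
  then have P: "?P = 1 / (cf_denom x (Suc n) + ?t * cf_denom x n)"
    using cf_prod_denom[OF assms, of n] by (simp add: field_simps)
  have *: "0 \<le> ?t * cf_denom x n" "?t * cf_denom x n \<le> cf_denom x n"
    using t q by (simp_all add: mult_left_le_one_le)
  show "?P \<le> 1 / cf_denom x (Suc n)"
    unfolding P using q * by (intro divide_left_mono) auto
  show "1 / (cf_denom x (Suc n) + cf_denom x n) \<le> ?P"
    unfolding P using q * by (intro divide_left_mono mult_pos_pos) auto
  show "?P > 0"
    by (intro prod_pos) (simp add: cf_tail_bounds[OF assms])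
qed

section \<open>Best approximation and distance of points with a common prefix\<close>

text \<open>By \<open>cf_det\<close> the pair (Q, P) is an integer combination of two consecutive
  convergents with coefficients \<open>u\<close> and \<open>v\<close>. Their errors have opposite
  signs, and the range of \<open>Q\<close> forces \<open>u\<close> and \<open>v\<close> to have
  opposite signs unless \<open>v = 0\<close>, so nothing cancels.\<close>

lemma cf_best_approximation:
  fixes x :: real and P :: int and Q :: nat
  assumes x: "cf_infinite x" and Q: "1 \<le> Q" "Q < cf_denom x (Suc n)"
  shows "(\<Prod>k\<le>n. cf_tail x k) \<le> \<bar>Q * x - P\<bar>"
proof -
  let ?p = "\<lambda>n. int (cf_numer x n)" and ?q = "\<lambda>n. int (cf_denom x n)" and ?t = "cf_tail x (Suc n)"
  let ?D = "\<Prod>k\<le>n. cf_tail x k"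
  define u where "u = (-1) ^ Suc n * (P * ?q (Suc n) - int Q * ?p (Suc n))"
  define v where "v = (-1) ^ Suc n * (?p n * int Q - ?q n * P)"
  have sq: "(-1) ^ Suc n * (-1) ^ Suc n = (1::int)"
    by (simp flip: power_add)
  have "u * ?q n + v * ?q (Suc n) = (-1) ^ Suc n * int Q * (?p n * ?q (Suc n) - ?p (Suc n) * ?q n)"
    by (simp only: u_def v_def) (simp add: algebra_simps)
  also have "\<dots> = ((-1) ^ Suc n * (-1) ^ Suc n) * int Q"
    unfolding cf_det by (simp only: mult_ac)
  finally have uvQ: "u * ?q n + v * ?q (Suc n) = int Q"
    unfolding sq by simp
  have "u * ?p n + v * ?p (Suc n) = (-1) ^ Suc n * P * (?p n * ?q (Suc n) - ?p (Suc n) * ?q n)"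
    by (simp only: u_def v_def) (simp add: algebra_simps)
  also have "\<dots> = ((-1) ^ Suc n * (-1) ^ Suc n) * P"
    unfolding cf_det by (simp only: mult_ac)
  finally have uvP: "u * ?p n + v * ?p (Suc n) = P"
    unfolding sq by simp
  have "Q * x - P = real_of_int (u * ?q n + v * ?q (Suc n)) * x - real_of_int (u * ?p n + v * ?p (Suc n))"
    unfolding uvQ uvP by simp
  also have "\<dots> = u * (cf_denom x n * x - cf_numer x n) + v * (cf_denom x (Suc n) * x - cf_numer x (Suc n))"
    by (simp add: algebra_simps del: cf_denom.simps cf_numer.simps)
  also have "\<dots> = (-1) ^ n * ?D * (u - v * ?t)"
    unfolding cf_error[OF x] by (simp add: algebra_simps)
  finally have eq: "\<bar>Q * x - P\<bar> = ?D * \<bar>u - v * ?t\<bar>"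
    using cf_prod_bounds(3)[OF x, of n] by (simp add: abs_mult power_abs)
  have t: "0 < ?t" "?t < 1"
    using cf_tail_bounds[OF x] by blast+
  have qn: "?q n \<ge> 1" "?q (Suc n) \<ge> 1"
    using cf_denom_pos[OF x] by (simp_all del: cf_denom.simps)
  have "1 \<le> \<bar>u - v * ?t\<bar>"
  proof -
    consider "v = 0" | "v \<ge> 1" | "v \<le> -1"
      by linarith
    then show ?thesis
    proof cases
      case 1
      then have "u \<noteq> 0"
        using uvQ Q by auto
      then have "1 \<le> \<bar>u\<bar>"
        by linarith
      then have "real_of_int 1 \<le> real_of_int \<bar>u\<bar>"
        by (simp only: of_int_le_iff)
      then show ?thesis
        using 1 by simp
    next
      case 2
      then have "v * ?q (Suc n) \<ge> ?q (Suc n)"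
        using qn by simp
      then have "u * ?q n < 0"
        using uvQ Q by linarith
      then have "u \<le> -1"
        using qn by (simp add: mult_less_0_iff)
      moreover have "v * ?t \<ge> 0"
        using 2 t by simp
      ultimately show ?thesis
        by linarith
    next
      case 3
      then have "v * ?q (Suc n) \<le> 0"
        using qn by (simp add: mult_le_0_iff)
      then have "u * ?q n > 0"
        using uvQ Q by linarith
      then have "u \<ge> 1"
        using qn by (simp add: zero_less_mult_iff)
      moreover have "v * ?t \<le> 0"
        using 3 t by (simp add: mult_le_0_iff)
      ultimately show ?thesis
        by linarith
    qed
  qed
  then show ?thesis
    unfolding eq using cf_prod_bounds(3)[OF x, of n] by simp
qed

text \<open>Inversion stretches a difference by the reciprocals of both tails, and equal digits
  cancel. The first factor stays a difference of reciprocals because the next digits are their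
  integer parts.\<close>

lemma cf_common_prefix:
  fixes x y :: real
  assumes x: "cf_infinite x" and y: "cf_infinite y"
    and "\<And>k. k < n \<Longrightarrow> cf_quot x (Suc k) = cf_quot y (Suc k)"
  shows "\<bar>x - y\<bar> = \<bar>1 / cf_tail x n - 1 / cf_tail y n\<bar> * (\<Prod>k\<le>n. cf_tail x k) * (\<Prod>k\<le>n. cf_tail y k)"
  using assms(3)
proof (induction n)
  case 0
  then show ?case
    using cf_tail_bounds[OF x, of 0] cf_tail_bounds[OF y, of 0] by (simp add: abs_if field_simps)
next
  case (Suc n)
  have "1 / cf_tail x n - 1 / cf_tail y n = cf_tail x (Suc n) - cf_tail y (Suc n)"
    unfolding inverse_cf_tail[OF x] inverse_cf_tail[OF y] using Suc.prems[of n] by simp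
  also have "\<dots> = - (1 / cf_tail x (Suc n) - 1 / cf_tail y (Suc n)) * cf_tail x (Suc n) * cf_tail y (Suc n)"
    using cf_tail_bounds[OF x, of "Suc n"] cf_tail_bounds[OF y, of "Suc n"] by (simp add: field_simps)
  finally have "\<bar>1 / cf_tail x n - 1 / cf_tail y n\<bar>
      = \<bar>1 / cf_tail x (Suc n) - 1 / cf_tail y (Suc n)\<bar> * cf_tail x (Suc n) * cf_tail y (Suc n)"
    using cf_tail_bounds[OF x, of "Suc n"] cf_tail_bounds[OF y, of "Suc n"]
    by (simp add: abs_mult abs_minus_commute)
  moreover have "\<bar>x - y\<bar> = \<bar>1 / cf_tail x n - 1 / cf_tail y n\<bar> * (\<Prod>k\<le>n. cf_tail x k) * (\<Prod>k\<le>n. cf_tail y k)"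
    using Suc by simp
  ultimately show ?case
    by (simp add: algebra_simps)
qed

section \<open>Points with prescribed digits\<close>

text \<open>Cylinders are closed here so that nested compact sets have a common point;
  \<open>cf_cylinder_step\<close> rules out the endpoints.\<close>

fun cf_cylinder :: "(nat \<Rightarrow> nat) \<Rightarrow> nat \<Rightarrow> real set" where
  "cf_cylinder d 0 = {0..1}"
| "cf_cylinder d (Suc n) = (\<lambda>t. 1 / (real (d 0) + t)) ` cf_cylinder (\<lambda>k. d (Suc k)) n"

lemma cf_cylinder_subset:
  assumes "\<And>k. d k \<ge> 1"
  shows "cf_cylinder d n \<subseteq> {0..1}"
  using assms
proof (induction n arbitrary: d)
  case (Suc n)
  have "real (d 0) \<ge> 1"
    using Suc.prems[of 0] by simp
  moreover have "cf_cylinder (\<lambda>k. d (Suc k)) n \<subseteq> {0..1}"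
    by (rule Suc.IH) (rule Suc.prems)
  ultimately show ?case
    by (auto simp: subset_iff field_simps intro!: add_nonneg_nonneg) 
qed simp

lemma cf_cylinder_compact:
  assumes "\<And>k. d k \<ge> 1"
  shows "compact (cf_cylinder d n)" "cf_cylinder d n \<noteq> {}" "cf_cylinder d (Suc n) \<subseteq> cf_cylinder d n"
  using assms
proof (induction n arbitrary: d)
  case 0
  {
    case 1 then show ?case by simp
  next
    case 2 then show ?case by simp
  next
    case 3 then show ?case using cf_cylinder_subset[of d "Suc 0"] by simp
  }
next
  case (Suc n)
  {
    case 1
    have d: "real (d 0) \<ge> 1"
      using 1[of 0] by simp
    have "continuous_on (cf_cylinder (\<lambda>k. d (Suc k)) n) (\<lambda>t. 1 / (real (d 0) + t))"
      using cf_cylinder_subset[of "\<lambda>k. d (Suc k)" n] 1 d by (intro continuous_intros) fastforce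
    then show ?case
      using Suc(1) 1 by (auto intro!: compact_continuous_image)
  next
    case 2
    then show ?case using Suc(2)[of "\<lambda>k. d (Suc k)"] by simp
  next
    case 3
    then show ?case using Suc(3)[of "\<lambda>k. d (Suc k)"] by (auto simp del: cf_cylinder.simps simp: cf_cylinder.simps(2)[of d])
  }
qed

lemma cf_cylinder_Inter:
  assumes "\<And>k. d k \<ge> 1"
  obtains x where "\<And>n. x \<in> cf_cylinder d n"
proof -
  note cyl = cf_cylinder_compact[of d, OF assms]
  have "\<Inter> (range (cf_cylinder d)) \<noteq> {}"
  proof (rule compact_nest)
    show "cf_cylinder d n \<subseteq> cf_cylinder d m" if "m \<le> n" for m n
      by (rule lift_Suc_antimono_le[where f = "cf_cylinder d", OF cyl(3) that])
  qed (rule cyl)+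
  then show thesis
    using that by blast
qed

text \<open>Two further digits put \<open>t\<close> strictly between 0 and 1. Hence the floor of
  \<open>1 / x\<close> reads off \<open>d 0\<close>, and the Gauss map shifts the digit
  sequence.\<close>

lemma cf_cylinder_step:
  assumes d: "\<And>k. d k \<ge> 1" and x: "\<And>n. x \<in> cf_cylinder d n"
  shows "0 < x" "x < 1" "nat \<lfloor>1 / x\<rfloor> = d 0" "gauss_map x \<in> cf_cylinder (\<lambda>k. d (Suc k)) n"
proof -
  define t where "t = 1 / x - d 0"
  have t_cyl: "t \<in> cf_cylinder (\<lambda>k. d (Suc k)) n" for n
  proof -
    obtain s where s: "x = 1 / (real (d 0) + s)" "s \<in> cf_cylinder (\<lambda>k. d (Suc k)) n"
      using x[of "Suc n"] by auto
    then have "s \<ge> 0"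
      using cf_cylinder_subset[of "\<lambda>k. d (Suc k)" n] d by auto
    then have "t = s"
      using s d[of 0] by (simp add: t_def)
    then show ?thesis
      using s by simp
  qed
  obtain s r where s: "t = 1 / (real (d 1) + s)" and r: "s = 1 / (real (d 2) + r)" "r \<in> {0..1}"
    using t_cyl[of 2] by (auto simp: numeral_2_eq_2)
  have d1: "real (d 1) \<ge> 1" "real (d 0) \<ge> 1"
    using d[of 1] d[of 0] by simp_all
  have "s > 0"
    using r d[of 2] by (simp add: add_pos_nonneg)
  then have t0: "t > 0"
    using s d1 by simp
  have t1: "t < 1"
    using s d1 \<open>s > 0\<close> by (simp del: One_nat_def)
  have x_eq: "x = 1 / (real (d 0) + t)"
    using x[of "Suc 0"] d1 by (auto simp: t_def)
  show "0 < x" "x < 1"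
    unfolding x_eq using t0 d1 by (simp_all add: field_simps)
  then have inv: "1 / x = real (d 0) + t"
    unfolding x_eq using t0 d1 by simp
  then have "\<lfloor>1 / x\<rfloor> = int (d 0)"
    using t0 t1 by (simp add: floor_eq_iff)
  then show "nat \<lfloor>1 / x\<rfloor> = d 0"
    by simp
  have "gauss_map x = t"
    using \<open>0 < x\<close> \<open>\<lfloor>1 / x\<rfloor> = int (d 0)\<close> inv by (simp add: gauss_map_def frac_def)
  then show "gauss_map x \<in> cf_cylinder (\<lambda>k. d (Suc k)) n"
    using t_cyl by simp
qed

lemma cf_with_digits:
  assumes d: "\<And>k. d k \<ge> 1"
  obtains x where "cf_infinite x" "\<And>n. cf_quot x (Suc n) = d n"
proof -
  obtain x where x: "\<And>n. x \<in> cf_cylinder d n"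
    using cf_cylinder_Inter[of d] d by blast
  have tail: "cf_tail x m \<in> cf_cylinder (\<lambda>k. d (k + m)) n" for m n
  proof (induction m arbitrary: n)
    case 0
    then show ?case using x by simp
  next
    case (Suc m)
    then show ?case
      using cf_cylinder_step(4)[of "\<lambda>k. d (k + m)" "cf_tail x m" n] d by (simp add: cf_tail_Suc)
  qed
  note step = cf_cylinder_step[of "\<lambda>k. d (k + m)" "cf_tail x m" for m, OF d tail]
  show thesis
  proof
    show "cf_infinite x"
      using step(1) step(1,2)[of 0] unfolding cf_infinite_def by (auto simp: less_imp_neq[THEN not_sym])
    show "cf_quot x (Suc n) = d n" for n
      using step(3)[of n] by (simp add: cf_quot_Suc)
  qed
qed

section \<open>Upper bound\<close>

lemma cf_tail_eq_0_mono: "m \<le> n \<Longrightarrow> cf_tail x m = 0 \<Longrightarrow> cf_tail x n = 0"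
  by (induction n rule: nat_induct_at_least) (simp_all add: cf_tail_Suc gauss_map_def)

text \<open>A terminating expansion meets the condition only at indices before its first vanishing
  tail, hence finitely often.\<close>

lemma G_set_iff:
  "x \<in> G_set \<Phi> \<longleftrightarrow> cf_infinite x \<and>
     infinite {n. n \<ge> 1 \<and> \<Phi> (cf_denom x n) < real (cf_quot x n) * real (cf_quot x (Suc n))}"
proof
  assume G: "x \<in> G_set \<Phi>"
  let ?S = "{n. n \<ge> 1 \<and> cf_tail x n \<noteq> 0 \<and> \<Phi> (cf_denom x n) < real (cf_quot x n) * real (cf_quot x (Suc n))}"
  have S: "infinite ?S"
    using G by (simp add: G_set_def cf_tail_def)
  have "cf_tail x n \<noteq> 0" for n
  proof
    assume "cf_tail x n = 0"
    then have "?S \<subseteq> {..<n}"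
      using cf_tail_eq_0_mono[of n _ x] not_le by blast
    then show False
      using S finite_subset by blast
  qed
  then show "cf_infinite x \<and> infinite {n. n \<ge> 1 \<and> \<Phi> (cf_denom x n) < real (cf_quot x n) * real (cf_quot x (Suc n))}"
    using G S by (simp add: cf_infinite_def G_set_def)
next
  assume "cf_infinite x \<and> infinite {n. n \<ge> 1 \<and> \<Phi> (cf_denom x n) < real (cf_quot x n) * real (cf_quot x (Suc n))}"
  then show "x \<in> G_set \<Phi>"
    by (simp add: cf_infinite_def G_set_def cf_tail_def)
qed

section \<open>Covering by balls indexed by consecutive denominators\<close>

text \<open>As \<open>e\<close> is a unit, \<open>q\<close> and \<open>r\<close> are coprime, so
  \<open>p\<close> and \<open>p'\<close> agree modulo \<open>q\<close>. Between 0 and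
  \<open>q\<close> only the two ends could collide, and the value 0 would make \<open>q\<close>
  divide \<open>e\<close>.\<close>

lemma numerator_unique:
  fixes p p' q r e :: int
  assumes q: "q \<ge> 2" and e: "\<bar>e\<bar> = 1"
    and p: "0 \<le> p" "p \<le> q" "q dvd p * r - e"
    and p': "0 \<le> p'" "p' \<le> q" "q dvd p' * r - e"
  shows "p = p'"
proof (rule ccontr)
  assume "p \<noteq> p'"
  have ndvd: "\<not> q dvd e"
  proof
    assume "q dvd e"
    then have "q dvd \<bar>e\<bar>"
      by simp
    then have "q \<le> \<bar>e\<bar>"
      using e by (intro zdvd_imp_le) auto
    then show False
      using q e by simp
  qed
  have "gcd q r dvd p * r - (p * r - e)"
    using p(3) by (meson dvd_diff dvd_mult dvd_trans gcd_dvd1 gcd_dvd2)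
  then have "gcd q r dvd \<bar>e\<bar>"
    by simp
  then have "gcd q r dvd 1"
    using e by (simp only:)
  then have "coprime q r"
    by (simp add: coprime_iff_gcd_eq_1)
  moreover have "q dvd (p * r - e) - (p' * r - e)"
    using p(3) p'(3) by (rule dvd_diff)
  then have "q dvd (p - p') * r"
    by (simp add: algebra_simps)
  ultimately have "q dvd p - p'"
    by (simp add: coprime_dvd_mult_left_iff)
  then have "q \<le> \<bar>p - p'\<bar>"
    using \<open>p \<noteq> p'\<close> zdvd_imp_le[of q "\<bar>p - p'\<bar>"] by simp
  then have "p = 0 \<or> p' = 0"
    using p p' by linarith
  then show False
    using p(3) p'(3) ndvd by auto
qed

lemma hausdorff_measure_G_set_eq_0:
  assumes s: "s > 0" and \<tau>: "\<tau> \<ge> 0" and gt: "s * (2 + \<tau>) > 2"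
    and ev: "\<forall>\<^sub>F q in at_top. q powr \<tau> \<le> \<Phi> q"
  shows "hausdorff_measure s (G_set \<Phi>) = 0"
proof -
  define \<rho> where "\<rho> = (\<lambda>(q::nat, r::nat, b::bool).
    if 2 \<le> q \<and> 1 \<le> r \<and> r \<le> q then 1 / (real r * real q powr (1 + \<tau>)) else 0)"
  \<comment> \<open>For actual convergents the choice is unique by \<open>numerator_unique\<close>;
    the Boolean says whether \<open>n\<close> is odd, which fixes the sign in
    \<open>cf_det\<close>.\<close>
  define c where "c = (\<lambda>(q::nat, r::nat, b::bool).
    real_of_int (SOME p. 0 \<le> p \<and> p \<le> int q \<and> int q dvd p * int r - (if b then 1 else -1)) / real q)"
  \<comment> \<open>Chosen so that, once a power of \<open>r\<close> is moved to \<open>q\<close>,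
    both variables carry the exponent \<open>- (1 + \<eta>)\<close>. The minimum with 1 keeps the
    moved exponent \<open>1 + \<eta> - min s 1\<close> nonnegative.\<close>
  define \<eta> where "\<eta> = (s * (1 + \<tau>) + min s 1 - 2) / 2"
  have "s * (1 + \<tau>) + min s 1 > 2"
  proof (cases "s \<le> 1")
    case True
    then show ?thesis using gt by (simp add: algebra_simps)
  next
    case False
    then show ?thesis
      using mult_left_mono[of 1 "1 + \<tau>" s] \<tau> by linarith
  qed
  then have \<eta>: "\<eta> > 0"
    by (simp add: \<eta>_def)
  define f where "f n = real n powr - (1 + \<eta>)" for n :: nat
  have sum_f: "summable f"
    unfolding f_def using \<eta> by (simp add: summable_real_powr_iff)
  have \<rho>_le: "\<rho> (q, r, b) powr s \<le> f q * f r" for q r b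
  proof (cases "2 \<le> q \<and> 1 \<le> r \<and> r \<le> q")
    case True
    then have q: "real q > 0" and r: "real r \<ge> 1" and rq: "real r \<le> real q"
      by auto
    have "\<rho> (q, r, b) powr s = real r powr (- s) * real q powr - (s * (1 + \<tau>))"
      using True by (simp add: \<rho>_def powr_divide powr_mult powr_powr powr_minus_divide mult.commute)
    also have "\<dots> \<le> real r powr (- min s 1) * real q powr - (s * (1 + \<tau>))"
      using r by (intro mult_right_mono powr_mono) auto
    \<comment> \<open>moving a power of \<open>r \<le> q\<close> over to \<open>q\<close> decouples the double sum\<close>
    also have "real r powr (- min s 1) = f r * real r powr (1 + \<eta> - min s 1)"
      using r by (simp add: f_def flip: powr_add)
    also have "f r * real r powr (1 + \<eta> - min s 1) * real q powr - (s * (1 + \<tau>))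
        \<le> f r * real q powr (1 + \<eta> - min s 1) * real q powr - (s * (1 + \<tau>))"
      using r rq \<eta> by (intro mult_right_mono mult_left_mono powr_mono2) (auto simp: f_def)
    also have "\<dots> = f r * f q"
    proof -
      have "1 + \<eta> - min s 1 + - (s * (1 + \<tau>)) = - (1 + \<eta>)"
        by (simp add: \<eta>_def field_simps)
      then show ?thesis
        by (simp only: mult.assoc f_def flip: powr_add)
    qed
    finally show ?thesis
      by (simp add: mult.commute)
  next
    case False
    then show ?thesis
      by (auto simp: \<rho>_def f_def)
  qed
  have f_nonneg: "f n \<ge> 0" for n
    by (simp add: f_def)
  have "(\<lambda>i. \<rho> i powr s) summable_on UNIV"
  proof (rule nonneg_bounded_partial_sums_imp_summable_on)
    show "\<forall>\<^sub>F F in finite_subsets_at_top UNIV. (\<Sum>i\<in>F. \<rho> i powr s) \<le> suminf f * (suminf f * 2)"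
    proof (rule eventually_finite_subsets_at_top_weakI)
      fix F :: "(nat \<times> nat \<times> bool) set" assume F: "finite F"
      define n where "n = Suc (Max (insert 0 (fst ` F \<union> (fst \<circ> snd) ` F)))"
      have "F \<subseteq> {..<n} \<times> {..<n} \<times> UNIV"
        using F by (force simp: n_def less_Suc_eq_le intro!: Max_ge)
      then have "(\<Sum>i\<in>F. \<rho> i powr s) \<le> (\<Sum>i\<in>{..<n} \<times> {..<n} \<times> UNIV. \<rho> i powr s)"
        by (intro sum_mono2) auto
      also have "\<dots> = (\<Sum>q<n. \<Sum>r<n. \<Sum>b\<in>UNIV. \<rho> (q, r, b) powr s)"
        by (simp add: sum.cartesian_product)
      also have "\<dots> \<le> (\<Sum>q<n. \<Sum>r<n. \<Sum>b\<in>(UNIV :: bool set). f q * f r)"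
        by (intro sum_mono \<rho>_le)
      also have "\<dots> = (\<Sum>q<n. f q) * ((\<Sum>r<n. f r) * 2)"
        by (simp add: sum_product sum_distrib_right sum_distrib_left mult_ac)
      also have "\<dots> \<le> suminf f * (suminf f * 2)"
        using sum_f f_nonneg
        by (intro mult_mono sum_le_suminf) (auto intro!: sum_nonneg mult_nonneg_nonneg suminf_nonneg)
      finally show "(\<Sum>i\<in>F. \<rho> i powr s) \<le> suminf f * (suminf f * 2)" .
    qed
  qed auto
  moreover have "infinite {i. dist x (c i) \<le> \<rho> i}" if x: "x \<in> G_set \<Phi>" for x
  proof
    assume fin: "finite {i. dist x (c i) \<le> \<rho> i}"
    have inf: "cf_infinite x"
      using x by (simp add: G_set_iff)
    obtain Q where Q: "\<And>q. q \<ge> Q \<Longrightarrow> q powr \<tau> \<le> \<Phi> q"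
      using ev unfolding eventually_at_top_linorder by blast
    \<comment> \<open>If only finitely many balls contained \<open>x\<close>, then \<open>B\<close>
      would bound their denominators; an index from \<open>L\<close> on gives \<open>q > B\<close>
      along with \<open>q \<ge> 2\<close> and \<open>q \<ge> Q\<close>.\<close>
    define B where "B = Max (insert 0 (fst ` {i. dist x (c i) \<le> \<rho> i}))"
    define L where "L = B + nat \<lceil>Q\<rceil> + 2"
    have "infinite {n. n \<ge> 1 \<and> \<Phi> (cf_denom x n) < real (cf_quot x n) * real (cf_quot x (Suc n))}"
      using x by (simp add: G_set_iff)
    then obtain n where "n \<ge> L" and G: "\<Phi> (cf_denom x n) < real (cf_quot x n) * real (cf_quot x (Suc n))"
      unfolding infinite_nat_iff_unbounded_le by blast
    then obtain m where n: "n = Suc m"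
      by (cases n) (auto simp: L_def)
    define q where "q = cf_denom x n"
    define r where "r = cf_denom x m"
    have "q \<ge> L"
      using cf_denom_ge[OF inf, of n] \<open>n \<ge> L\<close> by (simp add: q_def)
    then have q2: "q \<ge> 2" and qQ: "real q \<ge> Q" and qB: "q > B"
      by (auto simp: L_def) linarith
    have r: "1 \<le> r" "r \<le> q"
      using cf_denom_pos[OF inf, of m] cf_denom_mono[OF inf, of m] by (simp_all add: r_def q_def n)
    define e :: int where "e = (if odd n then 1 else -1)"
    define p where "p = int (cf_numer x n)"
    have det: "int (cf_numer x m) * int q - p * int r = - e"
      using cf_det[of x m] by (auto simp: p_def q_def r_def n e_def)
    have dvd: "int q dvd p * int r - e"
    proof
      show "p * int r - e = int q * int (cf_numer x m)"
        using det by (simp add: algebra_simps)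
    qed
    have p: "0 \<le> p" "p \<le> int q"
      using cf_numer_le_denom[OF inf, of n] by (simp_all add: p_def q_def)
    have "(SOME p. 0 \<le> p \<and> p \<le> int q \<and> int q dvd p * int r - e) = p"
      using p dvd numerator_unique[of "int q" e] q2 by (intro some_equality) (auto simp: e_def)
    then have c: "c (q, r, odd n) = p / q"
      by (simp add: c_def e_def)
    have q0: "real q > 0"
      using q2 by simp
    have a: "cf_quot x n * r \<le> q" "cf_quot x (Suc n) * q \<le> cf_denom x (Suc n)"
      using cf_denom_Suc[of x] by (simp_all add: q_def r_def n)
    have a1: "real (cf_quot x (Suc n)) \<ge> 1"
      using cf_quot_pos[OF inf, of n] by simp
    have "real q powr \<tau> * r \<le> real (cf_quot x n) * real (cf_quot x (Suc n)) * r"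
      using Q[OF qQ] G by (intro mult_right_mono) (auto simp: q_def)
    also have "\<dots> = real (cf_quot x n * r) * real (cf_quot x (Suc n))"
      by simp
    also have "\<dots> \<le> real q * real (cf_quot x (Suc n))"
      using a(1) by (intro mult_right_mono) (simp_all only: of_nat_le_iff of_nat_0_le_iff)
    also have "\<dots> = real (cf_quot x (Suc n) * q)"
      by simp
    also have "\<dots> \<le> real (cf_denom x (Suc n))"
      using a(2) by (simp only: of_nat_le_iff)
    finally have big: "real q powr \<tau> * r \<le> real (cf_denom x (Suc n))" .
    have "dist x (c (q, r, odd n)) = \<bar>real q * x - p\<bar> / q"
      using q0 by (simp add: c dist_real_def abs_if field_simps)
    also have "\<bar>real q * x - p\<bar> = (\<Prod>k\<le>n. cf_tail x k)"
      using cf_error[OF inf, of n] cf_prod_bounds(3)[OF inf, of n] by (simp add: q_def p_def abs_mult power_abs)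
    also have "\<dots> \<le> 1 / real (cf_denom x (Suc n))"
      by (rule cf_prod_bounds[OF inf])
    also have "\<dots> \<le> 1 / (real q powr \<tau> * r)"
      using big r q0 cf_denom_pos[OF inf, of "Suc n"] by (intro divide_left_mono mult_pos_pos) (auto simp del: cf_denom.simps)
    also have "1 / (real q powr \<tau> * r) / q = \<rho> (q, r, odd n)"
      using q2 r q0 by (simp add: \<rho>_def powr_add mult_ac)
    finally have "dist x (c (q, r, odd n)) \<le> \<rho> (q, r, odd n)"
      using q0 by (simp add: divide_right_mono)
    then have "q \<le> B"
      unfolding B_def using fin by (intro Max_ge) force+
    then show False
      using qB by simp
  qed
  moreover have "\<rho> i \<ge> 0" for i
    by (simp add: \<rho>_def split: prod.split)
  moreover have "infinite (UNIV :: (nat \<times> nat \<times> bool) set)"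
    by (simp add: finite_prod)
  ultimately show ?thesis
    using hausdorff_cantelli[of s \<rho> "G_set \<Phi>" c] s by blast
qed

section \<open>Upper bound for the dimension\<close>

lemma hausdorff_dim_le: "0 \<le> s \<Longrightarrow> hausdorff_measure s A = 0 \<Longrightarrow> hausdorff_dim A \<le> ereal s"
  unfolding hausdorff_dim_def by (intro Inf_lower) blast

text \<open>Any real \<open>s\<close> above \<open>2 / (\<tau> + 2)\<close> leaves room for an
  exponent \<open>\<tau>'\<close> with \<open>s * (2 + \<tau>') > 2\<close> whose power \<Phi>
  eventually dominates. An infinite \<tau> is included, with bound 0.\<close>

lemma hausdorff_dim_G_set_le:
  fixes \<Phi> :: "real \<Rightarrow> real"
  defines "\<tau> \<equiv> Liminf at_top (\<lambda>q :: real. ereal (ln (\<Phi> q) / ln q))"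
  assumes unbounded: "filterlim \<Phi> at_top at_top" and A: "A \<subseteq> G_set \<Phi>"
  shows "0 \<le> \<tau>" "hausdorff_dim A \<le> 2 / (\<tau> + 2)"
proof -
  have ge1: "\<forall>\<^sub>F q in at_top. \<Phi> q \<ge> 1"
    using unbounded by (simp add: filterlim_at_top)
  have gt1: "\<forall>\<^sub>F q :: real in at_top. q > 1"
    by (rule eventually_gt_at_top)
  show \<tau>: "0 \<le> \<tau>"
    unfolding \<tau>_def
    by (rule Liminf_bounded) (use ge1 gt1 in eventually_elim, simp)
  show "hausdorff_dim A \<le> 2 / (\<tau> + 2)"
  proof (rule dense_ge)
    fix z assume z: "2 / (\<tau> + 2) < z"
    show "hausdorff_dim A \<le> z"
    proof (cases z)
      case (real s)
      have "\<exists>\<tau>'. 0 \<le> \<tau>' \<and> 2 < s * (2 + \<tau>') \<and> (\<forall>\<^sub>F q in at_top. q powr \<tau>' \<le> \<Phi> q)" and "s > 0"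
      proof -
        have "0 \<le> 2 / (\<tau> + 2)"
          using \<tau> by (cases \<tau>) auto
        then show "s > 0" using z real by (metis ereal_less(2) le_less_trans)
        \<comment> \<open>The critical exponent, \<open>s * (2 + \<sigma>) = 2\<close>. It is
          negative exactly for \<open>s > 1\<close>, and then \<open>\<tau>' = 0\<close>
          suffices.\<close>
        define \<sigma> where "\<sigma> = 2 / s - 2"
        have "ereal \<sigma> < \<tau>"
        proof (cases \<tau>)
          case (real t)
          then show ?thesis using z \<open>z = ereal s\<close> \<open>s > 0\<close> \<tau> by (simp add: \<sigma>_def field_simps)
        qed (use \<tau> in auto)
        show "\<exists>\<tau>'. 0 \<le> \<tau>' \<and> 2 < s * (2 + \<tau>') \<and> (\<forall>\<^sub>F q in at_top. q powr \<tau>' \<le> \<Phi> q)"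
        proof (cases "\<sigma> < 0")
          case True
          have "\<forall>\<^sub>F q in at_top. q powr 0 \<le> \<Phi> q"
            using ge1 gt1 by eventually_elim simp
          moreover have "2 < s * (2 + 0)"
            using True \<open>s > 0\<close> by (simp add: \<sigma>_def field_simps)
          ultimately show ?thesis by blast
        next
          case False
          obtain \<tau>' where \<tau>': "ereal \<sigma> < ereal \<tau>'" "ereal \<tau>' < \<tau>"
            using ereal_dense2[OF \<open>ereal \<sigma> < \<tau>\<close>] by blast
          then have "\<forall>\<^sub>F q in at_top. ereal \<tau>' < ereal (ln (\<Phi> q) / ln q)"
            unfolding \<tau>_def by (intro less_LiminfD) auto
          then have "\<forall>\<^sub>F q in at_top. q powr \<tau>' \<le> \<Phi> q"
            using ge1 gt1
          proof eventually_elim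
            case (elim q)
            then have "\<tau>' * ln q \<le> ln (\<Phi> q)"
              by (simp add: field_simps)
            then have "exp (\<tau>' * ln q) \<le> exp (ln (\<Phi> q))"
              by simp
            then show ?case
              using elim by (simp add: powr_def)
          qed
          moreover have "2 < s * (2 + \<tau>')"
            using \<tau>' \<open>s > 0\<close> by (simp add: \<sigma>_def field_simps)
          ultimately show ?thesis
            using False \<tau>' by (intro exI[of _ \<tau>']) auto
        qed
      qed
      then obtain \<tau>' where "0 \<le> \<tau>'" "2 < s * (2 + \<tau>')" "\<forall>\<^sub>F q in at_top. q powr \<tau>' \<le> \<Phi> q"
        by blast
      then have "hausdorff_measure s (G_set \<Phi>) = 0"
        using \<open>s > 0\<close> by (intro hausdorff_measure_G_set_eq_0)
      then have "hausdorff_measure s A = 0"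
        using hausdorff_measure_mono[OF A, of s] by simp
      then show ?thesis
        unfolding real using \<open>s > 0\<close> by (intro hausdorff_dim_le) auto
    next
      case MInf
      then show ?thesis using z by simp
    qed simp
  qed
qed

section \<open>Lower bound\<close>

text \<open>
  A vertex of the tree stands for a finite word of digits: the denominators \<open>q\<^sub>n\<close> and \<open>q\<^sub>n\<^sub>-\<^sub>1\<close> of the word,
  the left end and the length of the subinterval of \<open>[0, 1)\<close> assigned to it, the denominator at which the
  next digit \<open>M\<close> is inserted, and whether the next digit is one of the large ones.
\<close>

datatype node = Node (den: nat) (prv: nat) (lft: real) (mass: real) (thr: real) (big: bool)

text \<open>The length of the cylinder set of a word with \<open>q\<^sub>n = q\<close> and \<open>q\<^sub>n\<^sub>-\<^sub>1 = r\<close>.\<close>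

definition cyl :: "nat \<Rightarrow> nat \<Rightarrow> real" where
  "cyl q r = 1 / (real q * (real q + real r))"

text \<open>Used to select the digit whose subinterval contains a given \<open>y\<close>, and the
  index \<open>k\<close> with q_k \<le> Q < q_{k+1}.\<close>

lemma ex_crossing:
  fixes f :: "nat \<Rightarrow> 'a::linorder"
  assumes "i \<le> j" "f i \<le> y" "y < f j"
  shows "\<exists>a. i \<le> a \<and> a < j \<and> f a \<le> y \<and> y < f (Suc a)"
  using assms
proof (induction j rule: dec_induct)
  case (step j)
  then show ?case
    by (cases "y < f j") (auto simp: not_less intro: less_SucI)
qed simp

section \<open>Parameters and vertices of the tree\<close>

text \<open>\<open>s\<close> is the dimension to be reached and \<open>s0\<close> an exponent that
  the usual digits achieve once \<open>N\<close> is large. The difference of \<open>2 * s0\<close>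
  and \<open>s * (2 + \<beta>)\<close> pays for one large digit, and \<open>4 \<le> C * M\<close>
  keeps the large digits below \<open>C * \<Psi> q\<close>.\<close>

locale cantor_tree =
  fixes \<Psi> :: "real \<Rightarrow> real" and C s \<beta> s0 T0 :: real and M N :: nat
  assumes mono: "mono_on {1..} \<Psi>" and pos: "\<And>q. q \<ge> 1 \<Longrightarrow> \<Psi> q > 0" and C: "C > 0"
    and s: "0 < s" "s \<le> s0" "s0 < 1" and \<beta>: "\<beta> \<ge> 0" "s * (2 + \<beta>) < 2 * s0"
    and M: "2 \<le> M" "M \<le> N" "4 \<le> C * M"
    and N: "(1 / 2) powr (1 - s0) \<le> N / (N + 2)"
    and T0: "T0 \<ge> 1" "\<And>q. q \<ge> T0 \<Longrightarrow> \<Psi> q \<ge> 2" "\<And>q. q \<ge> T0 \<Longrightarrow> C * \<Psi> q \<ge> N + 8"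
    and freq: "\<And>b. \<exists>q\<ge>b. \<Psi> q \<le> q powr \<beta>"
begin

text \<open>The \<open>+ 1\<close> makes \<open>M * A q\<close> strictly larger than
  \<open>\<Psi> q\<close>, as \<open>G_set\<close> demands.\<close>

definition A :: "nat \<Rightarrow> nat" where "A q = nat \<lfloor>\<Psi> q / M\<rfloor> + 1"
text \<open>Bounded digits end at some \<open>q < (N + 1) * T\<close>, and the digit
  \<open>M\<close> then multiplies the denominator by at most \<open>M + 1\<close>; so \<Psi> has to
  be controlled up to \<open>R * T\<close>.\<close>

definition R :: real where "R = (M + 1) * (N + 1)"
text \<open>The surplus exponent: \<open>\<delta> - 2 * s0 = - s * (2 + \<beta>)\<close>.\<close>

definition \<delta> :: real where "\<delta> = 2 * s0 - s * (2 + \<beta>)"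
text \<open>Collects the constants in
  \<open>12 * q'^2 * A q' \<le> Y * q powr (2 + \<beta>)\<close>, where \<open>q'\<close> is the
  denominator after the digit \<open>M\<close>.\<close>

definition Y :: real where "Y = 12 * (M + 1)\<^sup>2 * R powr \<beta>"

text \<open>
  The last condition makes the bound \<open>cyl\<^sup>s\<^sup>0\<close>, up to the constant accumulated so far, as strong as the
  bound \<open>(12 q\<^sup>2 A)\<^sup>-\<^sup>s\<close> required at the next vertex with large digits.
\<close>

definition good_thr :: "nat \<Rightarrow> nat \<Rightarrow> real \<Rightarrow> real \<Rightarrow> bool" where
  "good_thr q r m T \<longleftrightarrow> T0 \<le> T \<and> q < T \<and> \<Psi> (R * T) \<le> (R * T) powr \<beta> \<and>
     m * Y powr s \<le> T powr \<delta> * cyl q r powr s0"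

definition new_thr :: "nat \<Rightarrow> nat \<Rightarrow> real \<Rightarrow> real" where
  "new_thr q r m = (SOME T. good_thr q r m T)"

definition lo :: "node \<Rightarrow> nat" where
  "lo \<sigma> = (if big \<sigma> then A (den \<sigma>) else if thr \<sigma> \<le> den \<sigma> then M else 1)"

definition hi :: "node \<Rightarrow> nat" where
  "hi \<sigma> = (if big \<sigma> then 2 * A (den \<sigma>) else if thr \<sigma> \<le> den \<sigma> then M + 1 else N + 1)"

text \<open>The proportion of a cylinder on which the next digit is at least \<open>a\<close>.\<close>

definition gap :: "nat \<Rightarrow> nat \<Rightarrow> nat \<Rightarrow> real" where
  "gap q r a = (real q + real r) / (real a * real q + real r)"

text \<open>A distribution function on the digits, rising from 0 at \<open>lo\<close> to 1 at
  \<open>hi\<close>: uniform for large digits, concentrated on \<open>M\<close> when forced,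
  otherwise Lebesgue measure conditioned on digits up to \<open>N\<close>.\<close>

definition cum :: "node \<Rightarrow> nat \<Rightarrow> real" where
  "cum \<sigma> a =
     (if big \<sigma> then (real a - A (den \<sigma>)) / A (den \<sigma>)
      else if thr \<sigma> \<le> den \<sigma> then real a - M
      else (1 - gap (den \<sigma>) (prv \<sigma>) a) / (1 - gap (den \<sigma>) (prv \<sigma>) (N + 1)))"

definition child_mass :: "node \<Rightarrow> nat \<Rightarrow> real" where
  "child_mass \<sigma> a = mass \<sigma> * (cum \<sigma> (Suc a) - cum \<sigma> a)"

text \<open>A threshold is kept until a large digit has been used and is then renewed according to
  the new mass. Subintervals follow the order of the digits, so neighbouring digits own neighbouring
  intervals.\<close>

definition child :: "node \<Rightarrow> nat \<Rightarrow> node" where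
  "child \<sigma> a = Node (a * den \<sigma> + prv \<sigma>) (den \<sigma>) (lft \<sigma> + mass \<sigma> * cum \<sigma> a) (child_mass \<sigma> a)
     (if big \<sigma> then new_thr (a * den \<sigma> + prv \<sigma>) (den \<sigma>) (child_mass \<sigma> a) else thr \<sigma>)
     (\<not> big \<sigma> \<and> thr \<sigma> \<le> den \<sigma>)"

text \<open>
  The factor 12 pays for the distortion at the large digits, so that \<open>mass \<le> cyl\<^sup>s\<close> holds
  afterwards with constant 1 again and no constants accumulate along the tree.
\<close>

definition valid :: "node \<Rightarrow> bool" where
  "valid \<sigma> \<longleftrightarrow> 1 \<le> den \<sigma> \<and> prv \<sigma> \<le> den \<sigma> \<and> 0 < mass \<sigma> \<and>
     (if big \<sigma> then T0 \<le> den \<sigma> \<and> mass \<sigma> \<le> (12 * (real (den \<sigma>))\<^sup>2 * A (den \<sigma>)) powr - s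
      else mass \<sigma> \<le> cyl (den \<sigma>) (prv \<sigma>) powr s \<and>
        mass \<sigma> * Y powr s \<le> thr \<sigma> powr \<delta> * cyl (den \<sigma>) (prv \<sigma>) powr s0 \<and>
        den \<sigma> < (N + 1) * thr \<sigma> \<and> T0 \<le> thr \<sigma> \<and> \<Psi> (R * thr \<sigma>) \<le> (R * thr \<sigma>) powr \<beta>)"

lemma R_ge: "R \<ge> 1"
proof -
  have "1 * 1 \<le> real (M + 1) * real (N + 1)"
    by (intro mult_mono) auto
  then show ?thesis by (simp add: R_def)
qed

lemma Y_pos: "Y > 0"
  using R_ge by (simp add: Y_def)

lemma \<delta>_pos: "\<delta> > 0"
  using \<beta> by (simp add: \<delta>_def)

lemma A_ge: "A q \<ge> 1"
  by (simp add: A_def)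

lemma A_gt: "\<Psi> q < M * A q"
proof -
  have "\<Psi> q / M < A q"
    unfolding A_def by linarith
  then show ?thesis
    using M by (simp add: field_simps)
qed

lemma A_le:
  assumes "T0 \<le> q"
  shows "A q \<le> \<Psi> q" "2 * A q + 1 \<le> C * \<Psi> q"
proof -
  have \<Psi>: "\<Psi> q \<ge> 2" "C * \<Psi> q \<ge> 8"
    using T0(2,3)[of q] assms by auto
  have A: "A q \<le> \<Psi> q / M + 1"
    unfolding A_def using \<Psi> M by (simp add: le_floor_iff)
  have "\<Psi> q / M \<le> \<Psi> q / 2"
    using \<Psi> M by (intro divide_left_mono) auto
  then show "A q \<le> \<Psi> q"
    using A \<Psi> by linarith
  have "4 * (\<Psi> q / M) \<le> C * M * (\<Psi> q / M)"
    using M \<Psi> by (intro mult_right_mono) auto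
  also have "\<dots> = C * \<Psi> q"
    using M by simp
  finally show "2 * A q + 1 \<le> C * \<Psi> q"
    using A \<Psi> by linarith
qed

lemma cyl_pos: "1 \<le> q \<Longrightarrow> cyl q r > 0"
  by (simp add: cyl_def add_pos_nonneg)

lemma cyl_le: "1 \<le> q \<Longrightarrow> cyl q r \<le> 1 / (real q)\<^sup>2"
  unfolding cyl_def power2_eq_square by (intro divide_left_mono mult_left_mono) (auto intro!: mult_pos_pos add_pos_nonneg)

lemma new_thr:
  assumes "1 \<le> q" "0 < m"
  shows "good_thr q r m (new_thr q r m)"
  unfolding new_thr_def
proof (rule someI_ex)
  \<comment> \<open>The last entry solves
    \<open>T powr \<delta> = m * Y powr s / cyl q r powr s0\<close>, which is possible as
    \<open>\<delta> > 0\<close>. Asking \<open>freq\<close> for a value beyond \<open>R * b\<close>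
    leaves \<open>T \<ge> b\<close> after division by \<open>R\<close>.\<close>
  define b where "b = max (max T0 (q + 1)) ((m * Y powr s / cyl q r powr s0) powr (1 / \<delta>))"
  obtain Q where Q: "Q \<ge> R * b" "\<Psi> Q \<le> Q powr \<beta>"
    using freq by blast
  define T where "T = Q / R"
  have RT: "R * T = Q"
    using R_ge by (simp add: T_def)
  have "b \<le> T"
    using Q(1) R_ge by (simp add: T_def field_simps)
  then have T: "T0 \<le> T" "q < T" "(m * Y powr s / cyl q r powr s0) powr (1 / \<delta>) \<le> T"
    by (auto simp: b_def)
  have "m * Y powr s / cyl q r powr s0 = ((m * Y powr s / cyl q r powr s0) powr (1 / \<delta>)) powr \<delta>"
    using \<delta>_pos assms Y_pos by (simp add: powr_powr)
  also have "\<dots> \<le> T powr \<delta>"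
    using T(3) \<delta>_pos by (intro powr_mono2) auto
  finally have "m * Y powr s \<le> T powr \<delta> * cyl q r powr s0"
    using cyl_pos[OF assms(1), of r] by (simp add: field_simps)
  then have "good_thr q r m T"
    using T Q(2) RT by (simp add: good_thr_def)
  then show "\<exists>T. good_thr q r m T" ..
qed

text \<open>The proportion of one digit is the ratio of child to parent cylinder. With
  \<open>u \<ge> q + r\<close> it is a product of a factor at most 1 and a factor at most
  1/2.\<close>

lemma gap_diff:
  assumes "1 \<le> q" "1 \<le> a"
  shows "gap q r a - gap q r (Suc a) = cyl (a * q + r) q / cyl q r"
    and "gap q r a - gap q r (Suc a) > 0"
    and "gap q r a - gap q r (Suc a) \<le> 1 / 2"
proof -
  have q: "real q > 0" and a: "real a \<ge> 1"
    using assms by auto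
  define u where "u = real a * real q + real r"
  have u: "u \<ge> real q + real r" "u > 0"
    using a q mult_right_mono[of 1 "real a" "real q"] by (simp_all add: u_def add_pos_nonneg)
  have eq: "gap q r a - gap q r (Suc a) = (real q + real r) / u * (real q / (u + real q))"
  proof -
    have "gap q r a = (real q + real r) / u" "gap q r (Suc a) = (real q + real r) / (u + real q)"
      by (simp_all add: gap_def u_def algebra_simps)
    moreover have "w / u - w / (u + real q) = w / u * (real q / (u + real q))" for w
      using u q by (simp add: field_simps)
    ultimately show ?thesis
      by simp
  qed
  show "gap q r a - gap q r (Suc a) = cyl (a * q + r) q / cyl q r"
  proof -
    have "real (a * q + r) = u"
      by (simp add: u_def)
    then show ?thesis
      using u q by (simp add: cyl_def eq)
  qed
  show "gap q r a - gap q r (Suc a) > 0"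
    unfolding eq using u q by (intro mult_pos_pos divide_pos_pos) auto
  have "(real q + real r) / u * (real q / (u + real q)) \<le> 1 * (1 / 2)"
    using u q by (intro mult_mono) (auto simp: field_simps)
  then show "gap q r a - gap q r (Suc a) \<le> 1 / 2"
    unfolding eq by simp
qed

text \<open>The worst case is \<open>r = q\<close>, where equality holds.\<close>

lemma gap_total:
  assumes "1 \<le> q" "r \<le> q"
  shows "N / (N + 2) \<le> 1 - gap q r (N + 1)"
proof -
  have q: "real q > 0" "real r \<le> real q"
    using assms by auto
  have "(real q + real r) * (real N + 2) \<le> 2 * (real (N + 1) * real q + real r)"
    using q mult_left_mono[of "real r" "real q" "real N"] by (simp add: algebra_simps)
  moreover have "real (N + 1) * real q + real r > 0"
    using q by (simp add: add_pos_nonneg)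
  ultimately have "gap q r (N + 1) \<le> 2 / (N + 2)"
    unfolding gap_def by (simp add: field_simps)
  then show ?thesis
    by (simp add: field_simps)
qed

lemma cum_ends:
  assumes "valid \<sigma>"
  shows "cum \<sigma> (lo \<sigma>) = 0" "cum \<sigma> (hi \<sigma>) = 1" "1 \<le> lo \<sigma>" "lo \<sigma> < hi \<sigma>"
proof -
  have N: "real N > 0"
    using M by simp
  then have "0 < N / (N + 2)"
    by simp
  moreover have "N / (N + 2) \<le> 1 - gap (den \<sigma>) (prv \<sigma>) (N + 1)"
    using assms by (intro gap_total) (auto simp: valid_def)
  ultimately have "0 < 1 - gap (den \<sigma>) (prv \<sigma>) (N + 1)"
    by linarith
  moreover have "gap (den \<sigma>) (prv \<sigma>) 1 = 1"
    using assms by (simp add: gap_def valid_def)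
  ultimately show "cum \<sigma> (lo \<sigma>) = 0" "cum \<sigma> (hi \<sigma>) = 1"
    using A_ge[of "den \<sigma>"] by (auto simp: cum_def lo_def hi_def)
  show "1 \<le> lo \<sigma>" "lo \<sigma> < hi \<sigma>"
    using A_ge[of "den \<sigma>"] M by (auto simp: lo_def hi_def)
qed

text \<open>The exponent varies because both mass bounds in \<open>valid\<close> must be propagated,
  one with \<open>e = s\<close> and one with \<open>e = s0\<close>.\<close>

lemma cum_diff_bounded:
  assumes "valid \<sigma>" "\<not> big \<sigma>" "den \<sigma> < thr \<sigma>" "1 \<le> a"
  shows "0 < cum \<sigma> (Suc a) - cum \<sigma> a"
    and "e \<in> {0..s0} \<Longrightarrow> (cum \<sigma> (Suc a) - cum \<sigma> a) * cyl (den \<sigma>) (prv \<sigma>) powr e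
           \<le> cyl (a * den \<sigma> + prv \<sigma>) (den \<sigma>) powr e"
proof -
  let ?q = "den \<sigma>" and ?r = "prv \<sigma>"
  define \<rho> where "\<rho> = gap ?q ?r a - gap ?q ?r (Suc a)"
  define \<gamma> where "\<gamma> = 1 - gap ?q ?r (N + 1)"
  have q: "1 \<le> ?q" "?r \<le> ?q"
    using assms by (auto simp: valid_def)
  have \<rho>: "0 < \<rho>" "\<rho> \<le> 1 / 2" "\<rho> = cyl (a * ?q + ?r) ?q / cyl ?q ?r"
    using gap_diff[OF q(1) assms(4), of ?r] by (simp_all add: \<rho>_def)
  have \<gamma>: "(1 / 2) powr (1 - s0) \<le> \<gamma>"
    using gap_total[OF q] N by (simp add: \<gamma>_def)
  have "0 < (1 / 2 :: real) powr (1 - s0)"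
    by simp
  then have \<gamma>0: "\<gamma> > 0"
    using \<gamma> by linarith
  have cum: "cum \<sigma> (Suc a) - cum \<sigma> a = \<rho> / \<gamma>"
    using assms by (simp add: cum_def \<rho>_def \<gamma>_def diff_divide_distrib)
  show "0 < cum \<sigma> (Suc a) - cum \<sigma> a"
    unfolding cum using \<rho>(1) \<gamma>0 by simp
  assume e: "e \<in> {0..s0}"
  have "\<rho> = \<rho> powr s0 * \<rho> powr (1 - s0)"
    using \<rho>(1) by (simp flip: powr_add)
  \<comment> \<open>each ratio is at most 1/2, which gains a factor absorbing the loss from discarding digits above \<open>N\<close>\<close>
  also have "\<dots> \<le> \<rho> powr e * \<gamma>"
  proof (intro mult_mono)
    show "\<rho> powr s0 \<le> \<rho> powr e"
      using e \<rho>(1,2) by (intro powr_mono') auto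
    have "\<rho> powr (1 - s0) \<le> (1 / 2) powr (1 - s0)"
      using \<rho>(1,2) s by (intro powr_mono2) auto
    then show "\<rho> powr (1 - s0) \<le> \<gamma>"
      using \<gamma> by linarith
  qed auto
  finally have "\<rho> / \<gamma> \<le> \<rho> powr e"
    using \<gamma>0 by (simp add: field_simps)
  then have "\<rho> / \<gamma> * cyl ?q ?r powr e \<le> \<rho> powr e * cyl ?q ?r powr e"
    by (intro mult_right_mono) auto
  also have "\<dots> = (\<rho> * cyl ?q ?r) powr e"
    using \<rho>(1) cyl_pos[OF q(1), of ?r] by (simp add: powr_mult)
  also have "\<rho> * cyl ?q ?r = cyl (a * ?q + ?r) ?q"
    using \<rho>(3) cyl_pos[OF q(1), of ?r] by simp
  finally show "(cum \<sigma> (Suc a) - cum \<sigma> a) * cyl ?q ?r powr e \<le> cyl (a * ?q + ?r) ?q powr e"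
    unfolding cum .
qed

section \<open>Children of valid vertices are valid\<close>

text \<open>The new denominator is at most \<open>2 * A * q\<close>, so the new cylinder has length
  at least \<open>1 / (12 * q^2 * A^2)\<close>. The mass is divided by \<open>A\<close>, which is at
  least the division by \<open>A powr s\<close> that the second factor \<open>A\<close>
  requires.\<close>

lemma valid_child_big:
  assumes inv: "valid \<sigma>" and big: "big \<sigma>" and a: "A (den \<sigma>) \<le> a" "a < 2 * A (den \<sigma>)"
  shows "valid (child \<sigma> a)"
proof -
  let ?q = "den \<sigma>" and ?r = "prv \<sigma>" and ?A = "A (den \<sigma>)"
  define q' where "q' = a * ?q + ?r"
  define m' where "m' = child_mass \<sigma> a"
  have q: "1 \<le> ?q" "?r \<le> ?q" and m: "0 < mass \<sigma>" "mass \<sigma> \<le> (12 * (real ?q)\<^sup>2 * ?A) powr - s"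
    using inv big by (auto simp: valid_def)
  have A: "real ?A \<ge> 1"
    using A_ge[of ?q] by simp
  have a1: "1 \<le> a"
    using a A_ge[of ?q] by linarith
  have m': "m' = mass \<sigma> / ?A"
    using big by (simp add: m'_def child_mass_def cum_def flip: diff_divide_distrib)
  have m'_pos: "m' > 0"
    using m A by (simp add: m')
  have "1 * ?q \<le> a * ?q"
    using a1 by (intro mult_le_mono1)
  then have q'1: "1 \<le> q'" "?q \<le> q'"
    using q unfolding q'_def by linarith+
  have "q' \<le> (2 * ?A - 1) * ?q + ?q"
    unfolding q'_def using a q by (intro add_mono mult_le_mono1) auto
  also have "\<dots> = 2 * ?A * ?q"
    using A_ge[of ?q] by (cases ?A) auto
  finally have "real q' \<le> real (2 * ?A * ?q)"
    by (simp only: of_nat_le_iff)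
  then have q'_le: "real q' \<le> 2 * real ?A * ?q"
    by simp
  have "real ?q \<le> real ?A * ?q"
    using A mult_right_mono[of 1 "real ?A" "real ?q"] by simp
  then have "real q' + real ?q \<le> 3 * real ?A * ?q"
    using q'_le by linarith
  then have "real q' * (real q' + real ?q) \<le> (2 * real ?A * ?q) * (3 * real ?A * ?q)"
    using q'_le by (intro mult_mono) auto
  also have "\<dots> \<le> 12 * (real ?q)\<^sup>2 * ?A * ?A"
    by (simp add: power2_eq_square)
  finally have "real q' * (real q' + real ?q) \<le> 12 * (real ?q)\<^sup>2 * ?A * ?A" .
  then have cyl: "1 / (12 * (real ?q)\<^sup>2 * ?A * ?A) \<le> cyl q' ?q"
    unfolding cyl_def using q'1 A q by (intro divide_left_mono) (auto intro!: mult_pos_pos)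
  have "m' \<le> (12 * (real ?q)\<^sup>2 * ?A) powr - s * (real ?A) powr - 1"
    unfolding m' using m A by (simp add: powr_minus divide_inverse mult_right_mono)
  also have "\<dots> \<le> (12 * (real ?q)\<^sup>2 * ?A) powr - s * (real ?A) powr - s"
    using A s by (intro mult_left_mono powr_mono) auto
  also have "\<dots> = (1 / (12 * (real ?q)\<^sup>2 * ?A * ?A)) powr s"
    by (simp add: powr_minus_divide powr_divide powr_mult)
  also have "\<dots> \<le> cyl q' ?q powr s"
    using cyl s by (intro powr_mono2) auto
  finally have 1: "m' \<le> cyl q' ?q powr s" .
  have 2: "good_thr q' ?q m' (new_thr q' ?q m')"
    using q'1 m'_pos by (intro new_thr)
  then have "real q' < new_thr q' ?q m'" "0 \<le> new_thr q' ?q m'"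
    using T0 by (auto simp: good_thr_def)
  then have 3: "real q' < (N + 1) * new_thr q' ?q m'"
    by (simp add: distrib_right add_nonneg_pos less_le_trans)
  show ?thesis
    using q q'1 m'_pos 1 2 3 big unfolding valid_def
    by (simp add: child_def good_thr_def flip: q'_def m'_def)
qed

text \<open>Both mass bounds pass on by \<open>cum_diff_bounded\<close>. The denominator was below
  \<open>thr\<close> and grows by a factor of at most \<open>N + 1\<close>.\<close>

lemma valid_child_bounded:
  assumes inv: "valid \<sigma>" and big: "\<not> big \<sigma>" "den \<sigma> < thr \<sigma>" and a: "1 \<le> a" "a \<le> N"
  shows "valid (child \<sigma> a)"
proof -
  let ?q = "den \<sigma>" and ?r = "prv \<sigma>"
  define q' where "q' = a * ?q + ?r"
  define m' where "m' = child_mass \<sigma> a"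
  define \<rho> where "\<rho> = cum \<sigma> (Suc a) - cum \<sigma> a"
  have q: "1 \<le> ?q" "?r \<le> ?q" and m: "0 < mass \<sigma>" "mass \<sigma> \<le> cyl ?q ?r powr s"
    "mass \<sigma> * Y powr s \<le> thr \<sigma> powr \<delta> * cyl ?q ?r powr s0"
    using inv big by (auto simp: valid_def)
  have \<rho>: "\<rho> > 0" "\<rho> * cyl ?q ?r powr s \<le> cyl q' ?q powr s" "\<rho> * cyl ?q ?r powr s0 \<le> cyl q' ?q powr s0"
    using cum_diff_bounded[OF inv big a(1)] s by (simp_all add: \<rho>_def q'_def)
  have m'_eq: "m' = mass \<sigma> * \<rho>"
    by (simp add: m'_def child_mass_def \<rho>_def)
  have "1 * ?q \<le> a * ?q"
    using a by (intro mult_le_mono1)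
  then have q'1: "1 \<le> q'" "?q \<le> q'"
    using q unfolding q'_def by linarith+
  have "m' \<le> \<rho> * cyl ?q ?r powr s"
    using m \<rho> by (simp add: m'_eq mult.commute)
  also note \<rho>(2)
  finally have 1: "m' \<le> cyl q' ?q powr s" .
  have "m' * Y powr s \<le> \<rho> * (thr \<sigma> powr \<delta> * cyl ?q ?r powr s0)"
    using mult_left_mono[OF m(3), of \<rho>] \<rho> by (simp add: m'_eq mult_ac)
  also have "\<dots> = thr \<sigma> powr \<delta> * (\<rho> * cyl ?q ?r powr s0)"
    by simp
  also have "\<dots> \<le> thr \<sigma> powr \<delta> * cyl q' ?q powr s0"
    using \<rho>(3) by (intro mult_left_mono) auto
  finally have 2: "m' * Y powr s \<le> thr \<sigma> powr \<delta> * cyl q' ?q powr s0" .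
  have "q' \<le> N * ?q + ?q"
    unfolding q'_def using a q by (intro add_mono mult_le_mono1) auto
  then have "real q' \<le> real (N * ?q + ?q)"
    by (simp only: of_nat_le_iff)
  also have "\<dots> = (N + 1) * real ?q"
    by (simp add: algebra_simps)
  also have "\<dots> < (N + 1) * thr \<sigma>"
    using big by (intro mult_strict_left_mono) auto
  finally have 3: "real q' < (N + 1) * thr \<sigma>" .
  have "m' > 0"
    using m \<rho> by (simp add: m'_eq)
  then show ?thesis
    using q q'1 1 2 3 big inv unfolding valid_def
    by (simp add: child_def flip: q'_def m'_def)
qed

text \<open>Here the surplus is spent: \<open>thr \<le> q\<close> and
  \<open>cyl q r \<le> 1 / q^2\<close> turn the threshold bound into
  \<open>q powr (- s * (2 + \<beta>))\<close> up to \<open>Y powr - s\<close>, which is the bound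
  demanded before a large digit.\<close>

lemma valid_child_forced:
  assumes inv: "valid \<sigma>" and big: "\<not> big \<sigma>" "thr \<sigma> \<le> den \<sigma>"
  shows "valid (child \<sigma> M)"
proof -
  let ?q = "den \<sigma>" and ?r = "prv \<sigma>" and ?T = "thr \<sigma>"
  define q' where "q' = M * ?q + ?r"
  have q: "1 \<le> ?q" "?r \<le> ?q" and m: "0 < mass \<sigma>" "mass \<sigma> \<le> cyl ?q ?r powr s"
    "mass \<sigma> * Y powr s \<le> ?T powr \<delta> * cyl ?q ?r powr s0"
    and T: "?q < (N + 1) * ?T" "T0 \<le> ?T" "\<Psi> (R * ?T) \<le> (R * ?T) powr \<beta>"
    using inv big by (auto simp: valid_def)
  have m'_eq: "child_mass \<sigma> M = mass \<sigma>"
    using big by (simp add: child_mass_def cum_def)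
  have T0': "?T \<ge> 1"
    using T T0 by linarith
  have q0: "real ?q > 0"
    using q by simp
  have "1 * ?q \<le> M * ?q"
    using M by (intro mult_le_mono1) auto
  then have q'1: "1 \<le> q'" "?q \<le> q'"
    using q unfolding q'_def by linarith+
  then have q'T: "T0 \<le> q'"
    using T big by linarith
  have "real q' \<le> real (M * ?q + ?q)"
    unfolding q'_def using q by (simp only: of_nat_le_iff)
  then have q'_le: "real q' \<le> real (M + 1) * real ?q"
    by (simp add: algebra_simps)
  also have "\<dots> \<le> (M + 1) * ((N + 1) * ?T)"
    using T by (intro mult_left_mono) auto
  also have "\<dots> = R * ?T"
    by (simp add: R_def algebra_simps)
  finally have "real q' \<le> R * ?T" .
  \<comment> \<open>Monotonicity brings the bound at \<open>R * ?T\<close> down to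
    \<open>q'\<close>; afterwards \<open>?T \<le> ?q\<close> replaces the threshold by the
    denominator.\<close>
  then have "\<Psi> q' \<le> \<Psi> (R * ?T)"
    using q'1 by (intro mono_onD[OF mono]) auto
  also note T(3)
  also have "(R * ?T) powr \<beta> \<le> (R * ?q) powr \<beta>"
    using big R_ge T0' \<beta> by (intro powr_mono2 mult_left_mono) auto
  finally have "\<Psi> q' \<le> R powr \<beta> * ?q powr \<beta>"
    using R_ge by (simp add: powr_mult)
  then have A: "real (A q') \<le> R powr \<beta> * ?q powr \<beta>"
    using A_le(1)[OF q'T] by linarith
  have "12 * (real q')\<^sup>2 * A q' \<le> 12 * ((M + 1) * real ?q)\<^sup>2 * (R powr \<beta> * ?q powr \<beta>)"
    using A q'_le by (intro mult_mono power_mono) auto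
  also have "\<dots> = Y * (?q powr 2 * ?q powr \<beta>)"
    using q0 by (simp add: Y_def power_mult_distrib)
  also have "\<dots> = Y * ?q powr (2 + \<beta>)"
    by (simp add: powr_add)
  finally have *: "12 * (real q')\<^sup>2 * A q' \<le> Y * ?q powr (2 + \<beta>)" .
  have "0 < 12 * (real q')\<^sup>2 * A q'"
    using q'1 A_ge[of q'] by simp
  then have **: "(Y * ?q powr (2 + \<beta>)) powr - s \<le> (12 * (real q')\<^sup>2 * A q') powr - s"
    using * s by (intro powr_mono2') auto
  have "mass \<sigma> * Y powr s \<le> ?T powr \<delta> * cyl ?q ?r powr s0"
    by (rule m(3))
  also have "\<dots> \<le> ?q powr \<delta> * (1 / (real ?q)\<^sup>2) powr s0"
    using big T0' \<delta>_pos s cyl_le[OF q(1), of ?r] cyl_pos[OF q(1), of ?r]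
    by (intro mult_mono powr_mono2) auto
  also have "(1 / (real ?q)\<^sup>2) powr s0 = ?q powr (- 2 * s0)"
    using q0 by (simp add: powr_divide powr_minus_divide powr_powr flip: powr_numeral)
  also have "?q powr \<delta> * ?q powr (- 2 * s0) = ?q powr ((2 + \<beta>) * - s)"
    by (simp add: \<delta>_def algebra_simps flip: powr_add)
  also have "\<dots> = (?q powr (2 + \<beta>)) powr - s"
    by (simp only: powr_powr)
  finally have "Y powr - s * (mass \<sigma> * Y powr s) \<le> Y powr - s * (?q powr (2 + \<beta>)) powr - s"
    by (intro mult_left_mono) auto
  moreover have "Y powr - s * (mass \<sigma> * Y powr s) = mass \<sigma>"
    using Y_pos by (simp add: powr_minus)
  ultimately have "mass \<sigma> \<le> Y powr - s * (?q powr (2 + \<beta>)) powr - s"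
    by linarith
  also have "\<dots> = (Y * ?q powr (2 + \<beta>)) powr - s"
    using Y_pos by (simp add: powr_mult)
  also note **
  finally show ?thesis
    using q q'1 q'T m big unfolding valid_def
    by (simp add: child_def m'_eq flip: q'_def)
qed

lemma valid_child:
  assumes "valid \<sigma>" "lo \<sigma> \<le> a" "a < hi \<sigma>"
  shows "valid (child \<sigma> a)"
proof -
  consider "big \<sigma>" | "\<not> big \<sigma>" "thr \<sigma> \<le> den \<sigma>" | "\<not> big \<sigma>" "den \<sigma> < thr \<sigma>"
    by linarith
  then show ?thesis
  proof cases
    case 1
    then show ?thesis using assms by (intro valid_child_big) (auto simp: lo_def hi_def)
  next
    case 2
    then have "a = M" using assms by (auto simp: lo_def hi_def)
    then show ?thesis using 2 assms by (simp add: valid_child_forced)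
  next
    case 3
    then show ?thesis using assms by (intro valid_child_bounded) (auto simp: lo_def hi_def)
  qed
qed

section \<open>From parameters in [0, 1) to points\<close>

definition root :: node where
  "root = Node 1 0 0 1 (new_thr 1 0 1) False"

definition pick :: "real \<Rightarrow> node \<Rightarrow> nat" where
  "pick y \<sigma> = (SOME a. lo \<sigma> \<le> a \<and> a < hi \<sigma> \<and>
     lft \<sigma> + mass \<sigma> * cum \<sigma> a \<le> y \<and> y < lft \<sigma> + mass \<sigma> * cum \<sigma> (Suc a))"

primrec vertex :: "real \<Rightarrow> nat \<Rightarrow> node" where
  "vertex y 0 = root"
| "vertex y (Suc n) = child (vertex y n) (pick y (vertex y n))"

definition digit :: "real \<Rightarrow> nat \<Rightarrow> nat" where
  "digit y n = pick y (vertex y n)"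

definition point :: "real \<Rightarrow> real" where
  "point y = (SOME x. cf_infinite x \<and> (\<forall>n. cf_quot x (Suc n) = digit y n))"

lemma valid_root: "valid root"
proof -
  have "good_thr 1 0 1 (new_thr 1 0 1)"
    by (rule new_thr) auto
  moreover from this have "1 < new_thr 1 0 1"
    by (simp add: good_thr_def)
  then have "1 < (real N + 1) * new_thr 1 0 1"
    using mult_right_mono[of 1 "real N + 1" "new_thr 1 0 1"] by linarith
  ultimately show ?thesis
    by (simp add: valid_def root_def good_thr_def cyl_def add.commute)
qed

lemma pick:
  assumes "valid \<sigma>" "lft \<sigma> \<le> y" "y < lft \<sigma> + mass \<sigma>"
  shows "lo \<sigma> \<le> pick y \<sigma>" "pick y \<sigma> < hi \<sigma>"
    "lft \<sigma> + mass \<sigma> * cum \<sigma> (pick y \<sigma>) \<le> y" "y < lft \<sigma> + mass \<sigma> * cum \<sigma> (Suc (pick y \<sigma>))"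
proof -
  have "\<exists>a. lo \<sigma> \<le> a \<and> a < hi \<sigma> \<and>
     lft \<sigma> + mass \<sigma> * cum \<sigma> a \<le> y \<and> y < lft \<sigma> + mass \<sigma> * cum \<sigma> (Suc a)"
    using cum_ends[OF assms(1)] assms(2,3) by (intro ex_crossing) auto
  from someI_ex[OF this] show "lo \<sigma> \<le> pick y \<sigma>" "pick y \<sigma> < hi \<sigma>"
    "lft \<sigma> + mass \<sigma> * cum \<sigma> (pick y \<sigma>) \<le> y" "y < lft \<sigma> + mass \<sigma> * cum \<sigma> (Suc (pick y \<sigma>))"
    by (simp_all add: pick_def)
qed

lemma vertex_valid:
  assumes "y \<in> {0..<1}"
  shows "valid (vertex y n)" "lft (vertex y n) \<le> y" "y < lft (vertex y n) + mass (vertex y n)"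
proof -
  have "valid (vertex y n) \<and> lft (vertex y n) \<le> y \<and> y < lft (vertex y n) + mass (vertex y n)"
  proof (induction n)
    case 0
    then show ?case
      using assms valid_root by (simp add: root_def)
  next
    case (Suc n)
    define \<sigma> where "\<sigma> = vertex y n"
    have "valid (child \<sigma> (pick y \<sigma>))"
      using Suc pick[of \<sigma> y] by (intro valid_child) (auto simp: \<sigma>_def)
    moreover have "lft (child \<sigma> a) = lft \<sigma> + mass \<sigma> * cum \<sigma> a"
      "lft (child \<sigma> a) + mass (child \<sigma> a) = lft \<sigma> + mass \<sigma> * cum \<sigma> (Suc a)" for a
      by (simp_all add: child_def child_mass_def algebra_simps)
    ultimately show ?case
      using Suc pick[of \<sigma> y] unfolding vertex.simps \<sigma>_def by (metis (no_types, lifting))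
  qed
  then show "valid (vertex y n)" "lft (vertex y n) \<le> y" "y < lft (vertex y n) + mass (vertex y n)"
    by blast+
qed

lemma digit_bounds:
  assumes "y \<in> {0..<1}"
  shows "lo (vertex y n) \<le> digit y n" "digit y n < hi (vertex y n)"
    "lft (vertex y n) + mass (vertex y n) * cum (vertex y n) (digit y n) \<le> y"
    "y < lft (vertex y n) + mass (vertex y n) * cum (vertex y n) (Suc (digit y n))"
  unfolding digit_def by (rule pick[OF vertex_valid[OF assms]])+

lemma digit_pos: "y \<in> {0..<1} \<Longrightarrow> digit y n \<ge> 1"
  using digit_bounds(1)[of y n] cum_ends(3)[OF vertex_valid(1), of y n] by linarith

lemma point:
  assumes "y \<in> {0..<1}"
  shows "cf_infinite (point y)" "cf_quot (point y) (Suc n) = digit y n"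
proof -
  have "\<exists>x. cf_infinite x \<and> (\<forall>n. cf_quot x (Suc n) = digit y n)"
    using cf_with_digits[of "digit y"] digit_pos[OF assms] by blast
  from someI_ex[OF this] show "cf_infinite (point y)" "cf_quot (point y) (Suc n) = digit y n"
    by (simp_all add: point_def)
qed

lemma den_vertex:
  assumes "y \<in> {0..<1}"
  shows "den (vertex y n) = cf_denom (point y) n"
proof (induction n rule: induct_nat_012)
  case 0
  then show ?case by (simp add: root_def)
next
  case 1
  have "cf_quot (point y) (Suc 0) = digit y 0"
    using point(2)[OF assms] .
  then show ?case
    by (simp add: root_def child_def digit_def)
next
  case (ge2 n)
  have "prv (vertex y (Suc n)) = den (vertex y n)"
    by (simp add: child_def)
  moreover have "den (vertex y (Suc (Suc n)))
      = digit y (Suc n) * den (vertex y (Suc n)) + prv (vertex y (Suc n))"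
    unfolding vertex.simps(2)[of y "Suc n"] digit_def by (simp add: child_def)
  ultimately show ?case
    using ge2 point(2)[OF assms, of "Suc n"] by simp
qed

lemma den_ge: "y \<in> {0..<1} \<Longrightarrow> n \<le> den (vertex y n)"
  using cf_denom_ge point(1) by (simp add: den_vertex)

lemma big_Suc: "big (vertex y (Suc n)) \<longleftrightarrow> \<not> big (vertex y n) \<and> thr (vertex y n) \<le> den (vertex y n)"
  by (simp add: child_def)

text \<open>Without large digits the threshold would stay constant, but \<open>den \<ge> n\<close>
  eventually passes it and makes the next vertex big.\<close>

lemma infinitely_often_big:
  assumes y: "y \<in> {0..<1}"
  shows "\<exists>n\<ge>k. big (vertex y n)"
proof (rule ccontr)
  assume *: "\<not> (\<exists>n\<ge>k. big (vertex y n))"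
  have lt: "den (vertex y n) < thr (vertex y n)" if "n \<ge> k" for n
    using * big_Suc[of y n] that by (metis le_SucI not_less)
  have "thr (vertex y (k + n)) = thr (vertex y k)" for n
  proof (induction n)
    case (Suc n)
    have "\<not> big (vertex y (k + n))"
      using * by simp
    then show ?case
      using Suc by (simp add: child_def)
  qed simp
  then have "real (k + n) < thr (vertex y k)" for n
    using lt[of "k + n"] den_ge[OF y, of "k + n"] by (metis le_add1 of_nat_le_iff order_le_less_trans)
  moreover obtain n :: nat where "thr (vertex y k) < n"
    using reals_Archimedean2 by blast
  ultimately have "real (k + n) < n"
    using less_trans by blast
  then show False
    by simp
qed

lemma digit_le:
  assumes "y \<in> {0..<1}" "\<not> big (vertex y n)"
  shows "digit y n \<le> N"
  using digit_bounds(2)[OF assms(1), of n] assms M by (auto simp: hi_def split: if_splits)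

lemma digit_forced:
  assumes "y \<in> {0..<1}" "\<not> big (vertex y n)" "thr (vertex y n) \<le> den (vertex y n)"
  shows "digit y n = M"
  using digit_bounds(1,2)[OF assms(1), of n] assms by (auto simp: hi_def lo_def)

section \<open>Membership in \<open>G_set\<close> and exclusion from \<open>K_set\<close>\<close>

text \<open>A big vertex is always reached by the digit \<open>M\<close>, and the following digit is
  at least \<open>A q\<close> with \<open>M * A q > \<Psi> q\<close>.\<close>

lemma point_in_G_set:
  assumes y: "y \<in> {0..<1}"
  shows "point y \<in> G_set \<Psi>"
proof -
  let ?x = "point y"
  have "\<exists>n\<ge>k. n \<ge> 1 \<and> \<Psi> (cf_denom ?x n) < real (cf_quot ?x n) * real (cf_quot ?x (Suc n))" for k
  proof -
    obtain n where n: "n \<ge> k" "big (vertex y n)"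
      using infinitely_often_big[OF y] by blast
    then obtain m where m: "n = Suc m"
      by (cases n) (auto simp: root_def)
    have "digit y m = M"
      using n(2) y unfolding m big_Suc by (intro digit_forced) auto
    then have "cf_quot ?x n = M"
      using point(2)[OF y, of m] m by simp
    moreover have "A (den (vertex y n)) \<le> cf_quot ?x (Suc n)"
      using digit_bounds(1)[OF y, of n] n(2) point(2)[OF y, of n] by (simp add: lo_def)
    ultimately have "real M * A (den (vertex y n)) \<le> real (cf_quot ?x n) * real (cf_quot ?x (Suc n))"
      by (intro mult_mono) auto
    then show ?thesis
      using A_gt[of "den (vertex y n)"] n m den_vertex[OF y, of n] by (intro exI[of _ n]) auto
  qed
  then show ?thesis
    using point(1)[OF y] by (auto simp: G_set_iff infinite_nat_iff_unbounded_le)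
qed

text \<open>The 2 anticipates q_{k+1} + q_k \<le> (a_{k+1} + 2) q_k, applied to the lower bound in
  \<open>cf_prod_bounds\<close>.\<close>

lemma quot_le:
  assumes y: "y \<in> {0..<1}" and "T0 \<le> cf_denom (point y) n"
  shows "real (cf_quot (point y) (Suc n)) + 2 \<le> C * \<Psi> (cf_denom (point y) n)"
proof -
  let ?q = "cf_denom (point y) n"
  show ?thesis
  proof (cases "big (vertex y n)")
    case True
    have "digit y n < 2 * A ?q"
      using digit_bounds(2)[OF y, of n] True by (simp add: hi_def den_vertex[OF y])
    then have "real (digit y n) + 2 \<le> 2 * A ?q + 1"
      by linarith
    then show ?thesis
      using A_le(2)[OF assms(2)] point(2)[OF y] by simp
  next
    case False
    then show ?thesis
      using digit_le[OF y False] T0(3)[OF assms(2)] point(2)[OF y, of n] by simp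
  qed
qed

text \<open>For q_k \<le> Q < q_{k+1} best approximation reduces the claim to the k-th convergent,
  whose error is governed by the next digit; monotonicity of \<Psi> then passes from q_k to
  \<open>Q\<close>.\<close>

lemma point_approximation:
  fixes P :: int and Q :: nat
  assumes y: "y \<in> {0..<1}" and n: "T0 \<le> n" "cf_denom (point y) n \<le> Q"
  shows "1 / ((real Q)\<^sup>2 * (C * \<Psi> Q)) \<le> \<bar>point y - P / Q\<bar>"
proof -
  let ?x = "point y"
  note x = point(1)[OF y]
  have "Q < cf_denom ?x (Suc Q)"
    using cf_denom_ge[OF x, of "Suc Q"] by simp
  moreover have "n \<le> Suc Q"
    using cf_denom_ge[OF x, of n] n by linarith
  ultimately obtain k where k: "n \<le> k" "cf_denom ?x k \<le> Q" "Q < cf_denom ?x (Suc k)"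
    using ex_crossing[of n "Suc Q" "cf_denom ?x" Q] n by blast
  let ?q = "cf_denom ?x k" and ?a = "cf_quot ?x (Suc k)"
  have q1: "1 \<le> ?q"
    by (rule cf_denom_pos[OF x])
  then have Q: "real Q \<ge> 1"
    using k by linarith
  have "T0 \<le> ?q"
    using cf_denom_ge[OF x, of k] k n by linarith
  then have a: "?a + 2 \<le> C * \<Psi> ?q"
    using quot_le[OF y, of k] by simp
  also have "\<dots> \<le> C * \<Psi> Q"
    using k q1 C Q by (intro mult_left_mono mono_onD[OF mono]) auto
  finally have a': "?a + 2 \<le> C * \<Psi> Q" .
  have "cf_denom ?x (Suc k) \<le> ?a * ?q + ?q"
    using cf_denom_Suc_le[OF x] .
  then have "cf_denom ?x (Suc k) + ?q \<le> (?a + 2) * ?q"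
    by (simp add: algebra_simps)
  then have "real (cf_denom ?x (Suc k)) + ?q \<le> real ((?a + 2) * ?q)"
    by (simp only: flip: of_nat_add of_nat_le_iff)
  also have "\<dots> \<le> C * \<Psi> Q * Q"
    unfolding of_nat_mult using a' k by (intro mult_mono) auto
  finally have "1 / (C * \<Psi> Q * Q) \<le> 1 / (real (cf_denom ?x (Suc k)) + ?q)"
    using q1 by (intro divide_left_mono) (auto intro!: mult_pos_pos add_nonneg_pos C pos Q simp del: cf_denom.simps)
  also have "\<dots> \<le> (\<Prod>j\<le>k. cf_tail ?x j)"
    using cf_prod_bounds(2)[OF x, of k] by simp
  also have "\<dots> \<le> \<bar>Q * ?x - P\<bar>"
    using k Q by (intro cf_best_approximation[OF x]) auto
  finally have "1 / (C * \<Psi> Q * Q) / Q \<le> \<bar>Q * ?x - P\<bar> / Q"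
    by (intro divide_right_mono) auto
  also have "\<bar>Q * ?x - P\<bar> / Q = \<bar>?x - P / Q\<bar>"
    using Q by (simp add: abs_if field_simps)
  finally show ?thesis
    by (simp add: power2_eq_square mult_ac)
qed

lemma point_notin_K_set:
  assumes y: "y \<in> {0..<1}"
  shows "point y \<notin> K_set (\<lambda>q. C * \<Psi> q)"
proof -
  let ?x = "point y" and ?e = "\<lambda>q::nat. 1 / ((real q)\<^sup>2 * (C * \<Psi> q))"
  obtain n :: nat where n: "T0 \<le> n"
    using real_arch_simple by blast
  have fin: "finite {p :: int. \<bar>?x - p / q\<bar> < e}" if "q \<ge> 1" for q :: nat and e :: real
  proof (rule finite_subset)
    show "{p :: int. \<bar>?x - p / q\<bar> < e} \<subseteq> {\<lfloor>(?x - e) * q\<rfloor>..\<lceil>(?x + e) * q\<rceil>}"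
    proof
      fix p :: int assume "p \<in> {p. \<bar>?x - p / q\<bar> < e}"
      then have "(?x - e) * q \<le> p" "p \<le> (?x + e) * q"
        using that by (simp_all add: abs_less_iff field_simps)
      then show "p \<in> {\<lfloor>(?x - e) * q\<rfloor>..\<lceil>(?x + e) * q\<rceil>}"
        by (auto simp: floor_le_iff le_ceiling_iff)
    qed
  qed simp
  have "{(p :: int, q :: nat). q \<ge> 1 \<and> \<bar>?x - p / q\<bar> < ?e q}
      \<subseteq> (\<Union>q\<in>{1..<cf_denom ?x n}. {p. \<bar>?x - p / q\<bar> < ?e q} \<times> {q})"
  proof clarify
    fix p :: int and q :: nat
    assume q: "1 \<le> q" "\<bar>?x - p / q\<bar> < ?e q"
    then have "q < cf_denom ?x n"
      using point_approximation[OF y n, of q p] by linarith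
    then show "(p, q) \<in> (\<Union>q\<in>{1..<cf_denom ?x n}. {p. \<bar>?x - p / q\<bar> < ?e q} \<times> {q})"
      using q by auto
  qed
  moreover have "finite (\<Union>q\<in>{1..<cf_denom ?x n}. {p :: int. \<bar>?x - p / q\<bar> < ?e q} \<times> {q})"
    using fin by auto
  ultimately show ?thesis
    using finite_subset unfolding K_set_def by blast
qed

text \<open>
  After a branching vertex the tail stays away from 1, hence points in neighbouring
  cylinders are separated by a fixed proportion of the cylinder length.
\<close>

lemma tail_le:
  assumes y: "y \<in> {0..<1}" and "\<not> big (vertex y n)"
  shows "cf_tail (point y) n \<le> 1 - 1 / (N + 2)"
proof -
  note x = point(1)[OF y]
  let ?t = "\<lambda>n. cf_tail (point y) n"
  have inv: "1 / ?t k = digit y k + ?t (Suc k)" for k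
    using inverse_cf_tail[OF x] by (simp add: point(2)[OF y])
  have t: "0 < ?t k" "?t k < 1" for k
    using cf_tail_bounds[OF x] by blast+
  \<comment> \<open>Either the digit is \<open>M \<ge> 2\<close>, or the next digit is at most
    \<open>N\<close> and the next tail at least \<open>1 / (N + 1)\<close>. The reciprocal of the
    left side is \<open>1 - 1 / (N + 2)\<close>.\<close>
  have "1 + 1 / (N + 1) \<le> 1 / ?t n"
  proof (cases "thr (vertex y n) \<le> den (vertex y n)")
    case True
    then have "2 \<le> real (digit y n)"
      using digit_forced[OF y assms(2)] M by simp
    moreover have "1 / (N + 1) \<le> (1 :: real)"
      by simp
    ultimately show ?thesis
      unfolding inv using t[of "Suc n"] by linarith
  next
    case False
    then have "\<not> big (vertex y (Suc n))"
      unfolding big_Suc by blast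
    then have "1 / ?t (Suc n) \<le> N + 1"
      using digit_le[OF y, of "Suc n"] t[of "Suc (Suc n)"] unfolding inv by linarith
    then have "1 / (N + 1) \<le> ?t (Suc n)"
      using t[of "Suc n"] by (simp add: field_simps)
    then show ?thesis
      using digit_pos[OF y, of n] unfolding inv by linarith
  qed
  then show ?thesis
    using t[of n] by (simp add: field_simps)
qed

section \<open>Hoelder estimate\<close>

lemma vertex_cong: "(\<And>k. k < n \<Longrightarrow> digit y k = digit z k) \<Longrightarrow> vertex y n = vertex z n"
proof (induction n)
  case (Suc n)
  then show ?case
    using Suc.prems[of n] by (simp add: digit_def)
qed simp

lemma mass_le:
  assumes "valid \<sigma>"
  shows "mass \<sigma> \<le> (1 / (real (den \<sigma>))\<^sup>2) powr s"
    and "big \<sigma> \<Longrightarrow> mass \<sigma> \<le> (1 / ((real (den \<sigma>))\<^sup>2 * A (den \<sigma>))) powr s"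
proof -
  let ?q = "real (den \<sigma>)" and ?A = "real (A (den \<sigma>))"
  have q: "?q \<ge> 1" and A: "?A \<ge> 1"
    using assms A_ge[of "den \<sigma>"] by (auto simp: valid_def)
  have pos: "?q\<^sup>2 * ?A > 0"
    using q A by simp
  show *: "mass \<sigma> \<le> (1 / (?q\<^sup>2 * ?A)) powr s" if "big \<sigma>"
  proof -
    have "mass \<sigma> \<le> (12 * ?q\<^sup>2 * ?A) powr - s"
      using assms that by (simp add: valid_def)
    also have "\<dots> \<le> (?q\<^sup>2 * ?A) powr - s"
      using pos s by (intro powr_mono2') auto
    also have "\<dots> = (1 / (?q\<^sup>2 * ?A)) powr s"
      using pos by (simp add: powr_minus_divide powr_divide)
    finally show ?thesis .
  qed
  show "mass \<sigma> \<le> (1 / ?q\<^sup>2) powr s"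
  proof (cases "big \<sigma>")
    case True
    have "(1 / (?q\<^sup>2 * ?A)) powr s \<le> (1 / ?q\<^sup>2) powr s"
      using q A s by (intro powr_mono2) (auto simp: field_simps)
    then show ?thesis
      using *[OF True] by linarith
  next
    case False
    have "mass \<sigma> \<le> cyl (den \<sigma>) (prv \<sigma>) powr s"
      using assms False by (simp add: valid_def)
    also have "\<dots> \<le> (1 / ?q\<^sup>2) powr s"
      using cyl_le[of "den \<sigma>"] cyl_pos[of "den \<sigma>"] q s by (intro powr_mono2) (auto simp: less_imp_le)
    finally show ?thesis .
  qed
qed

text \<open>Equal digits put \<open>y\<close> and \<open>z\<close> into a common interval at every
  level, whose length tends to 0 by \<open>mass_le\<close>.\<close>

lemma digit_inj:
  assumes y: "y \<in> {0..<1}" and z: "z \<in> {0..<1}" and "y \<noteq> z"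
  shows "\<exists>n. digit y n \<noteq> digit z n"
proof (rule ccontr)
  assume "\<not> (\<exists>n. digit y n \<noteq> digit z n)"
  then have eq: "vertex y n = vertex z n" for n
    by (intro vertex_cong) auto
  have "\<bar>y - z\<bar> \<le> real (Suc n) powr - s" for n
  proof -
    have "\<bar>y - z\<bar> \<le> mass (vertex y (Suc n))"
      using vertex_valid(2,3)[OF y, of "Suc n"] vertex_valid(2,3)[OF z, of "Suc n"] eq[of "Suc n"] by (auto simp del: vertex.simps)
    also have "\<dots> \<le> (1 / (real (den (vertex y (Suc n))))\<^sup>2) powr s"
      by (rule mass_le(1)[OF vertex_valid(1)[OF y]])
    also have "\<dots> \<le> (1 / real (Suc n)) powr s"
    proof (intro powr_mono2 divide_left_mono)
      have "1 * real (Suc n) \<le> real (den (vertex y (Suc n))) * real (den (vertex y (Suc n)))"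
        using den_ge[OF y, of "Suc n"] by (intro mult_mono) auto
      then show "real (Suc n) \<le> (real (den (vertex y (Suc n))))\<^sup>2"
        by (simp add: power2_eq_square del: vertex.simps)
    qed (use s den_ge[OF y, of "Suc n"] in \<open>auto simp del: vertex.simps\<close>)
    also have "\<dots> = real (Suc n) powr - s"
      by (simp add: powr_divide powr_minus_divide)
    finally show ?thesis .
  qed
  moreover have "(\<lambda>n. real (Suc n) powr - s) \<longlonglongrightarrow> 0"
    using s by (intro tendsto_neg_powr filterlim_compose[OF filterlim_real_sequentially filterlim_Suc]) auto
  ultimately have "\<bar>y - z\<bar> \<le> 0"
    by (intro LIMSEQ_le_const) auto
  then show False
    using \<open>y \<noteq> z\<close> by simp
qed

text \<open>Both tails stay below \<open>1 - 1 / (N + 2)\<close>, so they leave at least the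
  proportion \<open>1 / (N + 2)\<close> of the digit difference. The remaining factors bound the two
  products in \<open>cf_common_prefix\<close> from below.\<close>

lemma point_distance:
  assumes y: "y \<in> {0..<1}" and z: "z \<in> {0..<1}"
    and eq: "\<And>k. k < n \<Longrightarrow> digit y k = digit z k" and ne: "digit y n \<noteq> digit z n"
  shows "\<bar>real (digit y n) - real (digit z n)\<bar> / ((N + 2) * ((real (digit y n) + 2) * (real (digit z n) + 2)
     * (real (den (vertex y n)))\<^sup>2)) \<le> \<bar>point y - point z\<bar>"
proof -
  let ?\<sigma> = "vertex y n" and ?a = "real (digit y n)" and ?b = "real (digit z n)"
  let ?q = "real (den (vertex y n))" and ?t = "cf_tail (point y)" and ?u = "cf_tail (point z)"
  have \<sigma>: "vertex z n = ?\<sigma>"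
    using vertex_cong[of n y z] eq by simp
  \<comment> \<open>A forced vertex admits only the digit \<open>M\<close>, so digits differ at a
    branching vertex, after which no large digit follows.\<close>
  have "\<not> (\<not> big ?\<sigma> \<and> thr ?\<sigma> \<le> den ?\<sigma>)"
    using digit_forced[OF y] digit_forced[OF z] ne by (metis \<sigma>)
  then have "\<not> big (vertex y (Suc n))" "\<not> big (vertex z (Suc n))"
    unfolding big_Suc \<sigma> by blast+
  then have t: "?t (Suc n) \<le> 1 - 1 / (N + 2)" "?u (Suc n) \<le> 1 - 1 / (N + 2)"
    using tail_le y z by blast+
  have t0: "0 < ?t (Suc n)" "0 < ?u (Suc n)"
    using cf_tail_bounds point y z by blast+
  have ab: "\<bar>?a - ?b\<bar> \<ge> 1"
    using ne by linarith
  have quot: "\<bar>?a - ?b\<bar> / (N + 2) \<le> \<bar>1 / ?t n - 1 / ?u n\<bar>"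
  proof -
    have "\<bar>?a - ?b\<bar> / (N + 2) = \<bar>?a - ?b\<bar> - (1 - 1 / (N + 2)) * \<bar>?a - ?b\<bar>"
      by (simp add: field_simps)
    also have "\<dots> \<le> \<bar>?a - ?b\<bar> - (1 - 1 / (N + 2)) * 1"
      using ab by (intro diff_left_mono mult_left_mono) auto
    also have "\<dots> \<le> \<bar>?a - ?b\<bar> - \<bar>?t (Suc n) - ?u (Suc n)\<bar>"
      using t t0 by simp
    also have "\<dots> \<le> \<bar>(?a + ?t (Suc n)) - (?b + ?u (Suc n))\<bar>"
      by linarith
    also have "\<dots> = \<bar>1 / ?t n - 1 / ?u n\<bar>"
      using inverse_cf_tail[OF point(1)[OF y], of n] inverse_cf_tail[OF point(1)[OF z], of n]
      by (simp add: point(2)[OF y] point(2)[OF z])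
    finally show ?thesis .
  qed
  have prod: "1 / ((real (digit w n) + 2) * ?q) \<le> (\<Prod>k\<le>n. cf_tail (point w) k)"
    if w: "w \<in> {0..<1}" "vertex w n = ?\<sigma>" for w
  proof -
    note x = point(1)[OF w(1)]
    have q: "cf_denom (point w) n = den ?\<sigma>"
      using den_vertex[OF w(1), of n] w(2) by simp
    have "cf_denom (point w) (Suc n) \<le> digit w n * den ?\<sigma> + den ?\<sigma>"
      using cf_denom_Suc_le[OF x, of n] unfolding q point(2)[OF w(1)] .
    then have "real (cf_denom (point w) (Suc n)) \<le> real (digit w n * den ?\<sigma> + den ?\<sigma>)"
      by (simp only: of_nat_le_iff)
    then have "real (cf_denom (point w) (Suc n)) + cf_denom (point w) n \<le> (real (digit w n) + 2) * ?q"
      unfolding q by (simp add: algebra_simps del: cf_denom.simps)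
    moreover have "real (cf_denom (point w) (Suc n)) + cf_denom (point w) n > 0"
      using cf_denom_pos[OF x, of n] by linarith
    moreover have "?q > 0"
      using cf_denom_pos[OF x, of n] unfolding q by simp
    ultimately have "1 / ((real (digit w n) + 2) * ?q) \<le> 1 / (real (cf_denom (point w) (Suc n)) + cf_denom (point w) n)"
      by (intro divide_left_mono mult_pos_pos) auto
    also have "\<dots> \<le> (\<Prod>k\<le>n. cf_tail (point w) k)"
      using cf_prod_bounds(2)[OF x, of n] by simp
    finally show ?thesis .
  qed
  have "\<bar>?a - ?b\<bar> / ((N + 2) * ((?a + 2) * (?b + 2) * ?q\<^sup>2))
      = \<bar>?a - ?b\<bar> / (N + 2) * (1 / ((?a + 2) * ?q)) * (1 / ((?b + 2) * ?q))"
    by (simp add: power2_eq_square mult_ac)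
  also have "\<dots> \<le> \<bar>1 / ?t n - 1 / ?u n\<bar> * (\<Prod>k\<le>n. ?t k) * (\<Prod>k\<le>n. ?u k)"
    using quot prod[OF y refl] prod[OF z \<sigma>] cf_prod_bounds(3)[OF point(1)[OF y], of n]
    by (intro mult_mono) (auto intro!: mult_nonneg_nonneg)
  also have "\<dots> = \<bar>point y - point z\<bar>"
    using cf_common_prefix[OF point(1)[OF y] point(1)[OF z], of n] eq by (simp add: point(2)[OF y] point(2)[OF z])
  finally show ?thesis .
qed

text \<open>Compare at the first differing digit. For bounded digits
  \<open>mass \<le> q powr (- 2 * s)\<close> meets a distance of order \<open>1 / q^2\<close>.
  Cylinders of large digits may lie much closer together, so there the digit difference must enter
  both sides.\<close>

lemma hoelder:
  assumes y: "y \<in> {0..<1}" and z: "z \<in> {0..<1}"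
  shows "\<bar>y - z\<bar> \<le> 2 * (9 * (N + 2) ^ 3) powr s * dist (point y) (point z) powr s"
proof (cases "y = z")
  case False
  define n where "n = (LEAST n. digit y n \<noteq> digit z n)"
  have ne: "digit y n \<noteq> digit z n"
    unfolding n_def using digit_inj[OF y z False] by (rule LeastI_ex)
  have eq: "digit y k = digit z k" if "k < n" for k
    using not_less_Least[of k] that by (auto simp: n_def)
  define \<sigma> where "\<sigma> = vertex y n"
  have \<sigma>z: "vertex z n = \<sigma>"
    using vertex_cong[of n y z] eq by (simp add: \<sigma>_def)
  have inv: "valid \<sigma>"
    unfolding \<sigma>_def by (rule vertex_valid[OF y])
  define q where "q = real (den \<sigma>)"
  have q: "q \<ge> 1"
    using inv by (simp add: q_def valid_def)
  define D where "D = \<bar>point y - point z\<bar>"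
  define a b where "a = real (digit y n)" and "b = real (digit z n)"
  have ab: "\<bar>a - b\<bar> \<ge> 1"
    using ne by (simp add: a_def b_def)
  have D: "\<bar>a - b\<bar> / ((N + 2) * ((a + 2) * (b + 2) * q\<^sup>2)) \<le> D"
    using point_distance[OF y z eq ne] by (simp add: a_def b_def q_def D_def \<sigma>_def)
  have ab0: "a \<ge> 0" "b \<ge> 0"
    by (simp_all add: a_def b_def)
  have forced: "big \<sigma> \<or> den \<sigma> < thr \<sigma>"
    using digit_forced[OF y, of n] digit_forced[OF z, of n] ne by (metis \<sigma>_def \<sigma>z not_less)
  show ?thesis
  proof (cases "big \<sigma>")
    case True
    define \<alpha> where "\<alpha> = real (A (den \<sigma>))"
    have \<alpha>: "\<alpha> \<ge> 1"
      using A_ge[of "den \<sigma>"] by (simp add: \<alpha>_def)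
    have range: "\<alpha> \<le> a" "\<alpha> \<le> b" "a + 1 \<le> 2 * \<alpha>" "b + 1 \<le> 2 * \<alpha>"
      using digit_bounds(1,2)[OF y, of n] digit_bounds(1,2)[OF z, of n] True
      by (simp_all add: \<sigma>z flip: \<sigma>_def) (simp_all add: lo_def hi_def a_def b_def \<alpha>_def)
    have yz: "\<bar>y - z\<bar> \<le> mass \<sigma> * ((\<bar>a - b\<bar> + 1) / \<alpha>)"
    proof -
      have cum: "cum \<sigma> (digit y n) = (a - \<alpha>) / \<alpha>" "cum \<sigma> (Suc (digit y n)) = (a + 1 - \<alpha>) / \<alpha>"
        "cum \<sigma> (digit z n) = (b - \<alpha>) / \<alpha>" "cum \<sigma> (Suc (digit z n)) = (b + 1 - \<alpha>) / \<alpha>"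
        using True by (simp_all add: cum_def a_def b_def \<alpha>_def add.commute)
      define \<mu> where "\<mu> = mass \<sigma> / \<alpha>"
      have \<mu>: "\<mu> > 0"
        using inv \<alpha> by (simp add: \<mu>_def valid_def)
      have "lft \<sigma> + \<mu> * (a - \<alpha>) \<le> y" "y < lft \<sigma> + \<mu> * (a + 1 - \<alpha>)"
        "lft \<sigma> + \<mu> * (b - \<alpha>) \<le> z" "z < lft \<sigma> + \<mu> * (b + 1 - \<alpha>)"
        using digit_bounds(3,4)[OF y, of n] digit_bounds(3,4)[OF z, of n]
        by (simp_all add: \<sigma>z cum \<mu>_def flip: \<sigma>_def)
      then have "y - z \<le> \<mu> * (a - b + 1)" "z - y \<le> \<mu> * (b - a + 1)"
        by (simp_all add: algebra_simps)
      moreover have "\<mu> * (a - b + 1) \<le> \<mu> * (\<bar>a - b\<bar> + 1)" "\<mu> * (b - a + 1) \<le> \<mu> * (\<bar>a - b\<bar> + 1)"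
        using \<mu> by (auto intro!: mult_left_mono)
      ultimately have "\<bar>y - z\<bar> \<le> \<mu> * (\<bar>a - b\<bar> + 1)"
        by linarith
      then show ?thesis
        by (simp add: \<mu>_def)
    qed
    \<comment> \<open>The relative digit distance: \<open>y\<close> and \<open>z\<close> differ by
      at most \<open>2 * u * mass \<sigma>\<close>, the points by at least a multiple of
      \<open>u / (q^2 * \<alpha>)\<close>, and \<open>u \<le> u powr s\<close> as
      \<open>u \<le> 1\<close>.\<close>
    define u where "u = \<bar>a - b\<bar> / \<alpha>"
    have u: "0 < u" "u \<le> 1"
      using ab \<alpha> range by (auto simp: u_def)
    have "u = u powr 1"
      using u by simp
    also have "\<dots> \<le> u powr s"
      using u s by (intro powr_mono') auto
    finally have us: "u \<le> u powr s" .
    have "(\<bar>a - b\<bar> + 1) / \<alpha> \<le> (2 * \<bar>a - b\<bar>) / \<alpha>"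
      using ab \<alpha> by (intro divide_right_mono) auto
    then have "(\<bar>a - b\<bar> + 1) / \<alpha> \<le> 2 * u powr s"
      using us by (simp add: u_def)
    then have "mass \<sigma> * ((\<bar>a - b\<bar> + 1) / \<alpha>) \<le> (1 / (q\<^sup>2 * \<alpha>)) powr s * (2 * u powr s)"
      using mass_le(2)[OF inv True] \<alpha> inv by (intro mult_mono) (auto simp: q_def \<alpha>_def valid_def)
    also have "\<dots> = 2 * (1 / (q\<^sup>2 * \<alpha>) * u) powr s"
      by (simp only: powr_mult mult_ac)
    finally have "\<bar>y - z\<bar> \<le> 2 * (1 / (q\<^sup>2 * \<alpha>) * u) powr s"
      using yz by linarith
    also have "\<dots> \<le> 2 * ((9 * (N + 2) ^ 3) * D) powr s"
    proof (intro mult_left_mono powr_mono2)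
      have "(a + 2) * (b + 2) \<le> (3 * \<alpha>) * (3 * \<alpha>)"
        using range ab0 \<alpha> by (intro mult_mono) auto
      then have "(N + 2) * ((a + 2) * (b + 2) * q\<^sup>2) \<le> (N + 2) * ((3 * \<alpha>) * (3 * \<alpha>) * q\<^sup>2)"
        by (intro mult_left_mono mult_right_mono) auto
      then have "\<bar>a - b\<bar> / ((N + 2) * ((3 * \<alpha>) * (3 * \<alpha>) * q\<^sup>2)) \<le> \<bar>a - b\<bar> / ((N + 2) * ((a + 2) * (b + 2) * q\<^sup>2))"
        using ab0 q \<alpha> by (intro divide_left_mono) (auto intro!: mult_pos_pos)
      also note D
      finally have *: "\<bar>a - b\<bar> / ((N + 2) * ((3 * \<alpha>) * (3 * \<alpha>) * q\<^sup>2)) \<le> D" .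
      have "q > 0" "\<alpha> > 0" "real (N + 2) > 0"
        using q \<alpha> by auto
      then have "\<bar>a - b\<bar> / (q\<^sup>2 * \<alpha>\<^sup>2) = 9 * (N + 2) * (\<bar>a - b\<bar> / ((N + 2) * ((3 * \<alpha>) * (3 * \<alpha>) * q\<^sup>2)))"
        by (simp add: power2_eq_square mult_ac)
      also have "\<dots> \<le> 9 * (N + 2) * D"
        using * by (intro mult_left_mono) auto
      also have "\<dots> \<le> 9 * (N + 2) ^ 3 * D"
      proof (intro mult_right_mono of_nat_mono mult_left_mono)
        show "N + 2 \<le> (N + 2) ^ 3"
          by (rule self_le_power) auto
      qed (auto simp: D_def)
      finally show "1 / (q\<^sup>2 * \<alpha>) * u \<le> 9 * (N + 2) ^ 3 * D"
        by (simp add: u_def power2_eq_square mult_ac)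
    qed (use u q \<alpha> s in auto)
    finally show ?thesis
      by (simp add: powr_mult D_def dist_real_def)
  next
    case False
    then have "a \<le> N" "b \<le> N"
      using digit_le[OF y, of n] digit_le[OF z, of n] by (simp_all add: a_def b_def \<sigma>_def \<sigma>z)
    have "\<bar>y - z\<bar> \<le> mass \<sigma>"
      using vertex_valid(2,3)[OF y, of n] vertex_valid(2,3)[OF z, of n] unfolding \<sigma>z \<sigma>_def[symmetric] by linarith
    also have "\<dots> \<le> (1 / q\<^sup>2) powr s"
      using mass_le(1)[OF inv] by (simp add: q_def)
    also have "\<dots> \<le> ((9 * (N + 2) ^ 3) * D) powr s"
    proof (intro powr_mono2)
      have "(a + 2) * (b + 2) \<le> (real N + 2) * (real N + 2)"
        using \<open>a \<le> N\<close> \<open>b \<le> N\<close> ab0 by (intro mult_mono) auto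
      then have "(N + 2) * ((a + 2) * (b + 2) * q\<^sup>2) \<le> (N + 2) * ((real N + 2) * (real N + 2) * q\<^sup>2)"
        by (intro mult_left_mono mult_right_mono) auto
      then have "1 / ((N + 2) * ((real N + 2) * (real N + 2) * q\<^sup>2)) \<le> 1 / ((N + 2) * ((a + 2) * (b + 2) * q\<^sup>2))"
        using ab0 q by (intro divide_left_mono) (auto intro!: mult_pos_pos)
      also have "\<dots> \<le> \<bar>a - b\<bar> / ((N + 2) * ((a + 2) * (b + 2) * q\<^sup>2))"
        using ab ab0 by (intro divide_right_mono) auto
      also note D
      finally have "1 / ((real N + 2) ^ 3 * q\<^sup>2) \<le> D"
        by (simp add: power3_eq_cube mult_ac add_ac)
      then have "1 / q\<^sup>2 \<le> (real N + 2) ^ 3 * D"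
        using q by (simp add: field_simps)
      also have "\<dots> \<le> 9 * ((real N + 2) ^ 3 * D)"
        by (simp add: D_def)
      finally show "1 / q\<^sup>2 \<le> 9 * (N + 2) ^ 3 * D"
        by (simp add: add.commute)
    qed (use s in auto)
    also have "\<dots> \<le> 2 * ((9 * (N + 2) ^ 3) * D) powr s"
      by simp
    finally show ?thesis
      by (simp add: powr_mult D_def dist_real_def)
  qed
qed simp

lemma hausdorff_measure_nonzero_G_minus_K:
  "hausdorff_measure s (G_set \<Psi> - K_set (\<lambda>q. C * \<Psi> q)) \<noteq> 0"
proof (rule hausdorff_measure_nonzero)
  show "0 < 2 * (9 * (real N + 2) ^ 3) powr s"
    by simp
  show "\<bar>y - z\<bar> \<le> 2 * (9 * (real N + 2) ^ 3) powr s * dist (point y) (point z) powr s"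
    if "y \<in> {0..<1}" "z \<in> {0..<1}" for y z
    using hoelder[OF that] by (simp add: add.commute)
qed (use s point_in_G_set point_notin_K_set in auto)

end

section \<open>Choice of parameters and the dimension formula\<close>

text \<open>Strictness of \<open>s * (t + 2) < 2\<close> leaves room for \<open>\<beta>\<close>
  above \<open>t\<close> and then for \<open>s0\<close> below 1, both taken as midpoints;
  \<open>M\<close>, \<open>N\<close> and \<open>T0\<close> follow in this order.\<close>

lemma cantor_tree_exists:
  fixes \<Psi> :: "real \<Rightarrow> real"
  assumes pos: "\<And>q. q \<ge> 1 \<Longrightarrow> \<Psi> q > 0"
    and mono: "mono_on {1..} \<Psi>"
    and unbounded: "filterlim \<Psi> at_top at_top"
    and C: "C > 0" and s: "s > 0" and t: "0 \<le> t" "s * (t + 2) < 2"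
    and liminf: "Liminf at_top (\<lambda>q :: real. ereal (ln (\<Psi> q) / ln q)) = ereal t"
  obtains \<beta> s0 T0 M N where "cantor_tree \<Psi> C s \<beta> s0 T0 M N"
proof -
  define \<beta> where "\<beta> = (t + (2 / s - 2)) / 2"
  have "t < 2 / s - 2"
    using s t by (simp add: field_simps)
  then have \<beta>: "t < \<beta>" "\<beta> < 2 / s - 2"
    by (auto simp: \<beta>_def)
  then have s\<beta>: "s * (2 + \<beta>) < 2"
    using s by (simp add: field_simps)
  define s0 where "s0 = (s * (2 + \<beta>) / 2 + 1) / 2"
  have s0: "s * (2 + \<beta>) < 2 * s0" "s0 < 1"
    using s\<beta> by (auto simp: s0_def field_simps)
  have "0 \<le> s * \<beta>"
    using s \<beta> t by simp
  then have "s \<le> s0"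
    using s0(1) unfolding distrib_left by linarith
  define h :: real where "h = (1 / 2) powr (1 - s0)"
  have "h < 1"
    using s0 powr_less_mono2[of "1 - s0" "1 / 2" 1] by (simp add: h_def)
  define M where "M = nat \<lceil>4 / C\<rceil> + 2"
  have "4 / C \<le> M"
    unfolding M_def by linarith
  then have M: "2 \<le> M" "4 \<le> C * M"
    using C by (simp_all add: M_def field_simps)
  \<comment> \<open>\<open>h \<le> N / (N + 2)\<close> is equivalent to
    \<open>2 / (1 - h) \<le> N + 2\<close>.\<close>
  define N where "N = M + nat \<lceil>2 / (1 - h)\<rceil>"
  have "2 / (1 - h) \<le> real (N + 2)"
    unfolding N_def by linarith
  then have N: "h \<le> N / (N + 2)"
    using \<open>h < 1\<close> by (simp add: field_simps)
  have "\<forall>\<^sub>F q in at_top. max 2 ((N + 8) / C) \<le> \<Psi> q"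
    using unbounded by (simp only: filterlim_at_top)
  then obtain b0 where b0: "\<And>q. q \<ge> b0 \<Longrightarrow> max 2 ((N + 8) / C) \<le> \<Psi> q"
    unfolding eventually_at_top_linorder by blast
  \<comment> \<open>Otherwise the lower limit would be at least \<open>\<beta>\<close>, which
    exceeds \<open>t\<close>.\<close>
  have freq: "\<exists>q\<ge>b. \<Psi> q \<le> q powr \<beta>" for b
  proof (rule ccontr)
    assume *: "\<not> (\<exists>q\<ge>b. \<Psi> q \<le> q powr \<beta>)"
    have "\<forall>\<^sub>F q in at_top. ereal \<beta> \<le> ereal (ln (\<Psi> q) / ln q)"
      using eventually_ge_at_top[of b] eventually_gt_at_top[of 1]
    proof eventually_elim
      case (elim q)
      then have "q powr \<beta> < \<Psi> q"
        using * by force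
      then have "ln (q powr \<beta>) < ln (\<Psi> q)"
        using elim pos[of q] by (subst ln_less_cancel_iff) auto
      then show ?case
        using elim by (simp add: field_simps)
    qed
    then have "ereal \<beta> \<le> ereal t"
      unfolding liminf[symmetric] by (rule Liminf_bounded)
    then show False
      using \<beta> by simp
  qed
  have "cantor_tree \<Psi> C s \<beta> s0 (max 1 b0) M N"
  proof
    show "\<Psi> q \<ge> 2" "C * \<Psi> q \<ge> N + 8" if "q \<ge> max 1 b0" for q
      using b0[of q] that C by (auto simp: field_simps)
  qed (use pos mono C s s0 \<open>s \<le> s0\<close> \<beta> t M N freq in \<open>auto simp: N_def h_def\<close>)
  then show thesis
    by (rule that)
qed

theorem theorem1p5:
  fixes \<Psi> :: "real \<Rightarrow> real" and C :: real
  assumes pos: "\<And>q. q \<ge> 1 \<Longrightarrow> \<Psi> q > 0"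
    and mono: "mono_on {1..} \<Psi>"
    and unbounded: "filterlim \<Psi> at_top at_top"
    and C: "C > 0"
  shows "hausdorff_dim (G_set \<Psi> - K_set (\<lambda>q. C * \<Psi> q)) =
           2 / (Liminf at_top (\<lambda>q :: real. ereal (ln (\<Psi> q) / ln q)) + 2)"
proof (rule antisym)
  let ?A = "G_set \<Psi> - K_set (\<lambda>q. C * \<Psi> q)"
  let ?\<tau> = "Liminf at_top (\<lambda>q :: real. ereal (ln (\<Psi> q) / ln q))"
  show "hausdorff_dim ?A \<le> 2 / (?\<tau> + 2)"
    using unbounded by (rule hausdorff_dim_G_set_le) blast
  have \<tau>: "0 \<le> ?\<tau>"
    using unbounded by (rule hausdorff_dim_G_set_le(1)) (rule order_refl)
  show "2 / (?\<tau> + 2) \<le> hausdorff_dim ?A"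
    unfolding hausdorff_dim_def
  proof (rule Inf_greatest, clarify)
    fix s :: real assume s: "0 \<le> s" "hausdorff_measure s ?A = 0"
    show "2 / (?\<tau> + 2) \<le> ereal s"
    \<comment> \<open>For infinite \<open>?\<tau>\<close> the left side is 0.\<close>
    proof (cases ?\<tau>)
      case (real t)
      have t: "0 \<le> t"
        using \<tau> real by simp
      show ?thesis
      proof (rule ccontr)
        assume "\<not> ?thesis"
        then have "s < 2 / (t + 2)"
          using real t by simp
        \<comment> \<open>The exponent \<open>s'\<close> is positive even if \<open>s = 0\<close>,
          and measure zero passes from \<open>s\<close> to \<open>s'\<close>.\<close>
        then obtain s' where s': "s < s'" "s' < 2 / (t + 2)"
          using dense by blast
        then have "s' > 0" "s' * (t + 2) < 2"
          using s t by (simp_all add: field_simps)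
        then obtain \<beta> s0 T0 M N where "cantor_tree \<Psi> C s' \<beta> s0 T0 M N"
          using cantor_tree_exists[of \<Psi> C s' t] pos mono unbounded C t real by blast
        then have "hausdorff_measure s' ?A \<noteq> 0"
          by (rule cantor_tree.hausdorff_measure_nonzero_G_minus_K)
        then show False
          using hausdorff_measure_eq_0_mono[OF s(2) s(1) s'(1)] by simp
      qed
    qed (use \<tau> s in auto)
  qed
qed

end
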